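(* Let $N\ge 1$ be an integer and $p>1$ a real number. Let $h:\mathbb{R}^N\to[0,\infty)$ be a nonnegative continuous function for which there exist constants $a>0$ and $\gamma>-p$ such that $h(x)=a|x|^\gamma$ for all $x$ with $|x|$ sufficiently large. Suppose that $u\in W^{1,p}_{\rm loc}(\mathbb{R}^N)\cap C(\mathbb{R}^N)$ is a nonnegative weak solution of $$-\operatorname{div}\left(|\nabla u|^{p-2}\nabla u\right)+h(x)\,u^q\le 0\quad\text{in }\mathbb{R}^N.$$ If $q>p-1$, then $u\equiv 0$.
   Context: A function $u\in W^{1,p}_{\rm loc}(\mathbb{R}^N)$ is a weak solution of $-\operatorname{div}(|\nabla u|^{p-2}\nabla u)\le f$ in $\mathbb{R}^N$ if $$\int_{\mathbb{R}^N}|\nabla u|^{p-2}\nabla u\cdot\nabla\varphi\,dx\ \le\ \int_{\mathbb{R}^N}f\varphi\,dx$$ for all $\varphi\in C_c^\infty(\mathbb{R}^N)$ with $\varphi\ge 0$; here $f=-h\,u^q$. *)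

theory Defs
  imports "HOL-Analysis.Analysis"
begin

primrec C_k :: "nat \<Rightarrow> ('a::euclidean_space \<Rightarrow> real) \<Rightarrow> bool" where
  "C_k 0 f \<longleftrightarrow> continuous_on UNIV f"
| "C_k (Suc k) f \<longleftrightarrow>
     (\<forall>x. f differentiable (at x)) \<and>
     (\<forall>b\<in>Basis. C_k k (\<lambda>x. frechet_derivative f (at x) b))"

definition test_functions :: "('a::euclidean_space \<Rightarrow> real) set" where
  "test_functions = {\<phi>. (\<forall>k. C_k k \<phi>) \<and> compact (closure {x. \<phi> x \<noteq> 0})}"

definition grad :: "('a::euclidean_space \<Rightarrow> real) \<Rightarrow> 'a \<Rightarrow> 'a" where
  "grad \<phi> x = (\<Sum>b\<in>Basis. frechet_derivative \<phi> (at x) b *\<^sub>R b)"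

definition Lp_loc :: "real \<Rightarrow> ('a::euclidean_space \<Rightarrow> 'b::euclidean_space) set" where
  "Lp_loc p = {f \<in> borel_measurable lebesgue.
     \<forall>K. compact K \<longrightarrow> set_integrable lebesgue K (\<lambda>x. norm (f x) powr p)}"

definition weak_gradient :: "('a::euclidean_space \<Rightarrow> real) \<Rightarrow> ('a \<Rightarrow> 'a) \<Rightarrow> bool" where
  "weak_gradient u G \<longleftrightarrow> u \<in> Lp_loc 1 \<and> G \<in> Lp_loc 1 \<and>
     (\<forall>\<phi>\<in>test_functions. \<forall>b\<in>Basis.
        (LINT x|lebesgue. u x * (grad \<phi> x \<bullet> b)) = - (LINT x|lebesgue. (G x \<bullet> b) * \<phi> x))"

definition W1p_loc :: "real \<Rightarrow> ('a::euclidean_space \<Rightarrow> real) set" where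
  "W1p_loc p = {u \<in> Lp_loc p. \<exists>G\<in>Lp_loc p. weak_gradient u G}"

text \<open>
  \<open>weak_p_laplace_le p u f\<close> says that \<open>u\<close> lies in \<open>W1p_loc p\<close> and satisfies
  \<open>- div (|\<nabla>u|^(p-2) \<nabla>u) \<le> f\<close> weakly. The weak gradient \<open>G\<close> is unique up to null sets, so
  the inequality does not depend on its choice. For \<open>p < 2\<close> the flux
  \<open>|G|^(p-2) G\<close> is read as \<open>0\<close> where \<open>G = 0\<close>, as it comes out with \<open>powr\<close> and \<open>*\<^sub>R\<close>.
\<close>

definition weak_p_laplace_le ::
  "real \<Rightarrow> ('a::euclidean_space \<Rightarrow> real) \<Rightarrow> ('a \<Rightarrow> real) \<Rightarrow> bool" where
  "weak_p_laplace_le p u f \<longleftrightarrow> u \<in> W1p_loc p \<and>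
     (\<exists>G\<in>Lp_loc p. weak_gradient u G \<and>
        (\<forall>\<phi>\<in>test_functions. (\<forall>x. \<phi> x \<ge> 0) \<longrightarrow>
           (LINT x|lebesgue. (norm (G x) powr (p - 2) *\<^sub>R G x) \<bullet> grad \<phi> x)
             \<le> (LINT x|lebesgue. f x * \<phi> x)))"

end

theory Submission
  imports Defs
begin

text \<open>
  The proof is a Caccioppoli estimate with a large power of the solution. Formally one tests the
  inequality with \<open>u^M * \<psi>\<close>, where \<open>M \<ge> 1\<close> is an integer and \<open>\<psi>\<close> a cutoff function, and obtains
  \<open>M * \<integral> u^(M-1) * \<psi> * |\<nabla>u|^p + \<integral> h * u^(q+M) * \<psi> \<le> \<integral> u^M * |\<nabla>u|^(p-1) * |\<nabla>\<psi>|\<close>.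
  For \<open>\<psi> = \<phi>^k\<close> with \<open>k\<close> large, two applications of Young's inequality absorb the right-hand side
  into half of the left-hand side, up to the error \<open>C * |\<nabla>\<phi>|^(p(1+\<sigma>)) * h^(-\<sigma>)\<close> with
  \<open>\<sigma> = (M - 1 + p) / (q - p + 1)\<close>; the second application is where \<open>q > p - 1\<close> enters. If \<open>\<phi>\<close> is
  constant on the ball of radius \<open>R\<close> and vanishes outside the ball of radius \<open>2 * R\<close>, the error lives
  on an annulus where \<open>h = a * |x|^\<gamma>\<close>, so that its integral is at most a constant times
  \<open>R^(N - p - (p + \<gamma>) * \<sigma>)\<close>. Because \<open>p + \<gamma> > 0\<close>, the exponent is negative once \<open>M\<close> is large. Letting
  \<open>R\<close> tend to infinity gives \<open>u^(M-1) * |\<nabla>u|^p = 0\<close> and \<open>h * u^(q+M) = 0\<close> almost everywhere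
  (lemmas \<open>gradient_term_absorbed\<close> and \<open>energy_decay\<close>).

  Hence \<open>u\<close> vanishes where \<open>|x|\<close> is large, and \<open>\<nabla>u = 0\<close> almost everywhere on \<open>{u \<noteq> 0}\<close>. Integrating
  by parts against \<open>x\<^sub>b * u\<close>, where \<open>x\<^sub>b\<close> is a coordinate, gives \<open>\<integral> u^2 = 0\<close>
  (lemma \<open>eq_0_if_gradient_vanishes_where_nonzero\<close>); this step covers the region where \<open>h\<close> may vanish.

  The functions \<open>u^M * \<psi>\<close> and \<open>x\<^sub>b * u\<close> are not smooth. Instead of extending the class of test
  functions, the solution itself is replaced by its mollifications \<open>u\<^sub>n\<close>: since \<open>M\<close> is an integer,
  \<open>u\<^sub>n^M * \<psi>\<close> is an honest test function and the classical product and power rules apply. The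
  gradient of \<open>u\<^sub>n\<close> is the mollified weak gradient, so the passage to the limit only needs that
  \<open>u\<^sub>n\<close> tends to \<open>u\<close> locally uniformly and that \<open>\<integral> B^(p-1) * |\<nabla>u\<^sub>n - \<nabla>u|\<close> tends to \<open>0\<close> on balls for each
  locally \<open>p\<close>-integrable weight \<open>B\<close> (lemmas \<open>mollify_weighted_L1\<close> and \<open>flux_limit\<close>); with
  \<open>B = |\<nabla>u|\<close> this handles the flux \<open>|\<nabla>u|^(p-2) * \<nabla>u\<close>.
\<close>

section \<open>Smooth functions and cutoff functions\<close>

lemma C_k_SucI:
  assumes "\<And>x. (f has_derivative f' x) (at x)"
    and "\<And>b. b \<in> Basis \<Longrightarrow> C_k k (\<lambda>x. f' x b)"
  shows "C_k (Suc k) f"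
proof -
  have "frechet_derivative f (at x) = f' x" for x
    using assms(1) frechet_derivative_at by metis
  then show ?thesis
    using assms by (auto simp: differentiable_def)
qed

lemma C_k_Suc_has_derivative:
  "C_k (Suc k) f \<Longrightarrow> (f has_derivative frechet_derivative f (at x)) (at x)"
  using frechet_derivative_works by auto

lemma C_k_SucD: "C_k (Suc k) f \<Longrightarrow> C_k k f"
proof (induction k arbitrary: f)
  case 0
  then have "f differentiable (at x)" for x by simp
  then show ?case
    by (simp add: continuous_at_imp_continuous_on differentiable_imp_continuous_within)
qed simp

lemma C_k_const: "C_k k (\<lambda>x. c)"
proof (induction k arbitrary: c)
  case (Suc k)
  then show ?case by (intro C_k_SucI[where f' = "\<lambda>x v. 0"]) auto
qed simp

lemma C_k_inner: "C_k k (\<lambda>x. x \<bullet> b)"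
proof (cases k)
  case (Suc k)
  show ?thesis unfolding Suc
    by (intro C_k_SucI[where f' = "\<lambda>x v. v \<bullet> b"] C_k_const) (auto intro!: derivative_eq_intros)
qed (auto intro!: continuous_intros)

lemma C_k_add: "C_k k f \<Longrightarrow> C_k k g \<Longrightarrow> C_k k (\<lambda>x. f x + g x)"
proof (induction k arbitrary: f g)
  case (Suc k)
  show ?case
  proof (intro C_k_SucI)
    fix x show "((\<lambda>x. f x + g x) has_derivative
        (\<lambda>v. frechet_derivative f (at x) v + frechet_derivative g (at x) v)) (at x)"
      using Suc.prems by (intro has_derivative_add C_k_Suc_has_derivative)
  qed (use Suc in auto)
qed (auto intro: continuous_on_add)

lemma C_k_mult: "C_k k f \<Longrightarrow> C_k k g \<Longrightarrow> C_k k (\<lambda>x. f x * g x)"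
proof (induction k arbitrary: f g)
  case (Suc k)
  show ?case
  proof (intro C_k_SucI)
    fix x show "((\<lambda>x. f x * g x) has_derivative
        (\<lambda>v. f x * frechet_derivative g (at x) v + frechet_derivative f (at x) v * g x)) (at x)"
      using Suc.prems by (intro has_derivative_mult C_k_Suc_has_derivative)
  next
    fix b :: 'a assume "b \<in> Basis"
    with Suc.prems show "C_k k (\<lambda>x. f x * frechet_derivative g (at x) b + frechet_derivative f (at x) b * g x)"
      by (intro C_k_add Suc.IH) (auto intro: C_k_SucD)
  qed
qed (auto intro: continuous_on_mult)

definition smooth :: "('a::euclidean_space \<Rightarrow> real) \<Rightarrow> bool" where
  "smooth f \<longleftrightarrow> (\<forall>k. C_k k f)"

lemma smooth_const [intro]: "smooth (\<lambda>x. c)"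
  and smooth_inner [intro]: "smooth (\<lambda>x. x \<bullet> b)"
  and smooth_add [intro]: "smooth f \<Longrightarrow> smooth g \<Longrightarrow> smooth (\<lambda>x. f x + g x)"
  and smooth_mult [intro]: "smooth f \<Longrightarrow> smooth g \<Longrightarrow> smooth (\<lambda>x. f x * g x)"
  unfolding smooth_def by (auto intro: C_k_const C_k_inner C_k_add C_k_mult)

lemma smooth_diff [intro]: "smooth f \<Longrightarrow> smooth g \<Longrightarrow> smooth (\<lambda>x. f x - g x)"
  using smooth_add[of f "\<lambda>x. -1 * g x"] smooth_mult[OF smooth_const[of "-1"], of g] by simp

lemma smooth_power [intro]: "smooth f \<Longrightarrow> smooth (\<lambda>x. f x ^ n)"
  by (induction n) auto

lemma smooth_sum [intro]: "(\<And>i. i \<in> I \<Longrightarrow> smooth (f i)) \<Longrightarrow> smooth (\<lambda>x. \<Sum>i\<in>I. f i x)"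
  by (induction I rule: infinite_finite_induct) auto

lemma smooth_inner_self [intro]: "smooth (\<lambda>x. x \<bullet> x)"
  by (subst euclidean_inner) (intro smooth_sum smooth_mult smooth_inner)

lemma smooth_has_derivative:
  "smooth f \<Longrightarrow> (f has_derivative frechet_derivative f (at x)) (at x)"
  unfolding smooth_def using C_k_Suc_has_derivative by blast

lemma smooth_continuous: "smooth f \<Longrightarrow> continuous_on S f"
  unfolding smooth_def using C_k.simps(1) continuous_on_subset by blast

lemma smooth_partial: "smooth f \<Longrightarrow> b \<in> Basis \<Longrightarrow> smooth (\<lambda>x. frechet_derivative f (at x) b)"
  unfolding smooth_def using C_k.simps(2) by blast

lemma C_k_translate: "C_k k f \<Longrightarrow> C_k k (\<lambda>y. f (y - x))"
proof (induction k arbitrary: f)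
  case 0
  then show ?case by (auto intro!: continuous_on_compose2[of UNIV f] continuous_intros)
next
  case (Suc k)
  show ?case
  proof (intro C_k_SucI)
    fix y show "((\<lambda>y. f (y - x)) has_derivative frechet_derivative f (at (y - x))) (at y)"
      by (rule has_derivative_compose[where f = "\<lambda>y. y - x" and f' = "\<lambda>v. v", simplified])
        (auto intro!: derivative_eq_intros C_k_Suc_has_derivative[OF Suc.prems])
  next
    fix b :: 'a assume "b \<in> Basis"
    then have "C_k k (\<lambda>y. frechet_derivative f (at y) b)" using Suc.prems by simp
    from Suc.IH[OF this] show "C_k k (\<lambda>y. frechet_derivative f (at (y - x)) b)" .
  qed
qed

text \<open>
  The outer function comes with the whole sequence \<open>F n\<close> of its derivatives: differentiating
  \<open>F n \<circ> g\<close> produces \<open>F (Suc n) \<circ> g\<close>, so the induction needs all of them at once.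
\<close>

lemma C_k_compose:
  assumes F: "\<And>n t. (F n has_real_derivative F (Suc n) t) (at t)"
    and g: "smooth g"
  shows "C_k k (\<lambda>x. F n (g x))"
proof (induction k arbitrary: n)
  case 0
  have "continuous_on UNIV (F n)"
    using F DERIV_continuous_on by blast
  then show ?case
    using smooth_continuous[OF g] by (auto intro: continuous_on_compose2)
next
  case (Suc k)
  show ?case
  proof (intro C_k_SucI)
    fix x show "((\<lambda>x. F n (g x)) has_derivative
        (\<lambda>v. F (Suc n) (g x) * frechet_derivative g (at x) v)) (at x)"
      using has_derivative_compose[OF smooth_has_derivative[OF g] F[unfolded has_field_derivative_def]] .
  next
    fix b :: 'a assume "b \<in> Basis"
    then show "C_k k (\<lambda>x. F (Suc n) (g x) * frechet_derivative g (at x) b)"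
      using smooth_partial[OF g] by (intro C_k_mult Suc.IH) (auto simp: smooth_def)
  qed
qed

lemma grad_inner: "b \<in> Basis \<Longrightarrow> grad f x \<bullet> b = frechet_derivative f (at x) b"
  by (simp add: grad_def)

lemma smooth_has_derivative_grad: "smooth f \<Longrightarrow> (f has_derivative (\<lambda>v. grad f x \<bullet> v)) (at x)"
proof -
  assume f: "smooth f"
  interpret bounded_linear "frechet_derivative f (at x)"
    using smooth_has_derivative[OF f] has_derivative_bounded_linear by blast
  have "frechet_derivative f (at x) v = grad f x \<bullet> v" for v
  proof -
    have "frechet_derivative f (at x) v = frechet_derivative f (at x) (\<Sum>b\<in>Basis. (v \<bullet> b) *\<^sub>R b)"
      by (simp add: euclidean_representation)
    also have "\<dots> = grad f x \<bullet> v"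
      unfolding sum scaleR grad_def inner_sum_left by (simp add: inner_commute mult.commute)
    finally show ?thesis .
  qed
  then show ?thesis using smooth_has_derivative[OF f, of x] by presburger
qed

lemma grad_eqI:
  assumes "(f has_derivative (\<lambda>v. w \<bullet> v)) (at x)"
  shows "grad f x = w"
  using frechet_derivative_at[OF assms, symmetric] by (simp add: grad_def euclidean_representation)

lemma smooth_grad_inner: "smooth f \<Longrightarrow> smooth (\<lambda>x. grad f x \<bullet> v)"
proof -
  assume f: "smooth f"
  have "(\<lambda>x. grad f x \<bullet> v) = (\<lambda>x. \<Sum>b\<in>Basis. frechet_derivative f (at x) b * (b \<bullet> v))"
    by (simp add: grad_def inner_sum_left)
  then show ?thesis using smooth_partial[OF f] by (auto intro!: smooth_sum smooth_mult)
qed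

lemma smooth_grad_continuous: "smooth f \<Longrightarrow> continuous_on S (grad f)"
  unfolding grad_def by (intro continuous_intros smooth_continuous smooth_partial)

text \<open>
  The smooth function \<open>exp (-1/t)\<close> for \<open>t > 0\<close>, extended by \<open>0\<close>, is the source of all test functions
  below. The derivative of \<open>P(1/t) * exp (-1/t)\<close> is \<open>Q(1/t) * exp (-1/t)\<close> with \<open>Q = X^2 * (P - P')\<close>; this
  recursion defines the polynomial factor of the \<open>n\<close>-th derivative \<open>theta n\<close>.
\<close>

fun theta_poly :: "nat \<Rightarrow> real poly" where
  "theta_poly 0 = 1"
| "theta_poly (Suc n) = monom 1 2 * (theta_poly n - pderiv (theta_poly n))"

definition theta :: "nat \<Rightarrow> real \<Rightarrow> real" where
  "theta n t = (if t > 0 then poly (theta_poly n) (inverse t) * exp (- inverse t) else 0)"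

lemma poly_times_exp_minus_at_top: "((\<lambda>x. poly P x * exp (- x)) \<longlongrightarrow> 0) at_top" for P :: "real poly"
proof -
  have "((\<lambda>x. \<Sum>i\<le>degree P. coeff P i * (x ^ i / exp x)) \<longlongrightarrow> (\<Sum>i\<le>degree P. coeff P i * 0)) at_top"
    by (intro tendsto_intros tendsto_power_div_exp_0)
  then show ?thesis
    by (simp add: poly_altdef sum_divide_distrib exp_minus field_simps)
qed

lemma theta_nonpos: "t \<le> 0 \<Longrightarrow> theta n t = 0"
  by (simp add: theta_def)

lemma theta_0_pos: "t > 0 \<Longrightarrow> theta 0 t > 0"
  by (simp add: theta_def)

lemma theta_0_nonneg: "theta 0 t \<ge> 0"
  by (simp add: theta_def)

lemma theta_0_le_1: "theta 0 t \<le> 1"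
  by (simp add: theta_def)

lemma theta_0_mono: "s \<le> t \<Longrightarrow> theta 0 s \<le> theta 0 t"
  by (auto simp: theta_def intro: le_imp_inverse_le)

text \<open>
  At \<open>t = 0\<close> the difference quotient from the right is a polynomial in \<open>1/t\<close> times \<open>exp (-1/t)\<close>, and
  the exponential wins.
\<close>

lemma theta_has_derivative: "(theta n has_real_derivative theta (Suc n) t) (at t)"
proof -
  let ?P = "theta_poly n"
  consider "t > 0" | "t < 0" | "t = 0" by linarith
  then show ?thesis
  proof cases
    case 1
    have "((\<lambda>t. poly ?P (inverse t) * exp (- inverse t)) has_real_derivative theta (Suc n) t) (at t)"
      using 1 by (auto intro!: derivative_eq_intros DERIV_chain'[OF _ poly_DERIV]
          simp: theta_def poly_monom algebra_simps power2_eq_square)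
    then show ?thesis
      by (rule has_field_derivative_transform_within_open[of _ _ _ "{0<..}"]) (use 1 in \<open>auto simp: theta_def\<close>)
  next
    case 2
    have "((\<lambda>t. 0) has_real_derivative theta (Suc n) t) (at t)"
      using 2 by (simp add: theta_def)
    then show ?thesis
      by (rule has_field_derivative_transform_within_open[of _ _ _ "{..<0}"]) (use 2 in \<open>auto simp: theta_def\<close>)
  next
    case 3
    have "((\<lambda>x. poly (monom 1 1 * ?P) x * exp (- x)) \<longlongrightarrow> 0) at_top"
      by (rule poly_times_exp_minus_at_top)
    then have "((\<lambda>h. theta n h / h) \<longlongrightarrow> 0) (at_right 0)"
      unfolding filterlim_at_right_to_top
      by (rule Lim_transform_eventually)
        (auto intro!: eventually_mono[OF eventually_gt_at_top[of 0]] simp: theta_def poly_monom field_simps)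
    moreover have "((\<lambda>h. theta n h / h) \<longlongrightarrow> 0) (at_left 0)"
      by (rule tendsto_eventually) (auto simp: eventually_at_filter theta_def)
    ultimately have "((\<lambda>h. theta n h / h) \<longlongrightarrow> 0) (at 0)"
      by (simp add: filterlim_at_split)
    then show ?thesis
      using 3 by (simp add: has_field_derivative_iff theta_def)
  qed
qed

lemma smooth_theta: "smooth g \<Longrightarrow> smooth (\<lambda>x. theta n (g x))"
  unfolding smooth_def[of "\<lambda>x. theta n (g x)"] using C_k_compose theta_has_derivative by blast

lemma test_functions_iff: "\<phi> \<in> test_functions \<longleftrightarrow> smooth \<phi> \<and> (\<exists>r. \<forall>x. norm x > r \<longrightarrow> \<phi> x = 0)"
proof -
  have "compact (closure {x. \<phi> x \<noteq> 0}) \<longleftrightarrow> bounded {x. \<phi> x \<noteq> 0}"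
    by (simp add: compact_closure)
  also have "\<dots> \<longleftrightarrow> (\<exists>r. \<forall>x. norm x > r \<longrightarrow> \<phi> x = 0)"
    unfolding bounded_iff by (auto simp: not_less[symmetric])
  finally show ?thesis by (auto simp: test_functions_def smooth_def)
qed

lemma test_function_bump:
  fixes r :: real
  assumes "r > 0"
  obtains \<eta> :: "'a::euclidean_space \<Rightarrow> real" where "\<eta> \<in> test_functions" "\<And>x. \<eta> x \<ge> 0"
    "\<And>x. norm x \<ge> r \<Longrightarrow> \<eta> x = 0" "\<And>x. norm x < r \<Longrightarrow> \<eta> x > 0"
proof
  define \<eta> :: "'a \<Rightarrow> real" where "\<eta> x = theta 0 (r\<^sup>2 - x \<bullet> x)" for x
  have *: "r\<^sup>2 - x \<bullet> x > 0 \<longleftrightarrow> norm x < r" for x :: 'a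
    using assms power_mono_iff[of r "norm x" 2] by (simp add: dot_square_norm not_le[symmetric])
  show z: "norm x \<ge> r \<Longrightarrow> \<eta> x = 0" for x
    using *[of x] by (simp add: \<eta>_def theta_nonpos)
  have "smooth \<eta>"
    unfolding \<eta>_def by (intro smooth_theta smooth_diff smooth_const smooth_inner_self)
  then show "\<eta> \<in> test_functions"
    using z less_imp_le by (auto simp: test_functions_iff)
qed (use assms in \<open>auto simp: theta_0_nonneg theta_0_pos dot_square_norm power_strict_mono\<close>)

text \<open>
  With \<open>c = theta 0 1\<close>, the proof takes \<open>\<phi> R x = theta 0 (c - theta 0 (|x|^2/R^2 - 1))\<close>. For
  \<open>|x| \<le> R\<close> the inner value is \<open>0\<close>, and for \<open>|x|^2 \<ge> 2 * R^2\<close> it is at least \<open>c\<close> because \<open>theta 0\<close> is monotone. This gives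
  a plateau of height \<open>theta 0 c\<close>, the same for all \<open>R\<close>, without integrals or quotients of smooth
  functions. The bound on the gradient is a matter of scaling.
\<close>

lemma cutoff_family:
  "\<exists>(\<phi> :: real \<Rightarrow> 'a::euclidean_space \<Rightarrow> real) (c :: real) (D :: real). c > 0 \<and> (\<forall>R>0.
      \<phi> R \<in> test_functions \<and> (\<forall>x. 0 \<le> \<phi> R x \<and> \<phi> R x \<le> 1 \<and> norm (grad (\<phi> R) x) \<le> D / R
      \<and> (norm x \<le> R \<longrightarrow> \<phi> R x = c \<and> grad (\<phi> R) x = 0)
      \<and> (norm x \<ge> 2 * R \<longrightarrow> \<phi> R x = 0 \<and> grad (\<phi> R) x = 0)))"
proof -
  define c where "c = theta 0 1"
  define \<phi> :: "real \<Rightarrow> 'a \<Rightarrow> real" where "\<phi> R x = theta 0 (c - theta 0 ((x \<bullet> x) / R\<^sup>2 - 1))" for R x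
  \<comment> \<open>the gradient of \<open>\<phi> R\<close> at \<open>x\<close> is \<open>- 2 / R^2 * d s\<close> times \<open>x\<close>, with \<open>s = |x|^2/R^2\<close>\<close>
  define d where "d s = theta 1 (c - theta 0 (s - 1)) * theta 1 (s - 1)" for s
  have d0: "d s = 0" if "s \<le> 1 \<or> s \<ge> 2" for s
    using that theta_0_mono[of 1 "s - 1"] by (auto simp: d_def c_def theta_nonpos)
  have cont: "continuous_on S (theta n)" for n S
    using DERIV_continuous_on[OF DERIV_subset[OF theta_has_derivative]] by blast
  have "continuous_on {1..2} d"
    unfolding d_def by (auto intro!: continuous_intros continuous_on_compose2[OF cont[of UNIV]])
  then have "bounded (d ` {1..2})"
    by (intro compact_imp_bounded compact_continuous_image) auto
  then obtain B where B: "\<And>s. s \<in> {1..2} \<Longrightarrow> \<bar>d s\<bar> \<le> B"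
    unfolding bounded_iff by fastforce
  have c: "c > 0" by (simp add: c_def theta_0_pos)
  have sq: "(x \<bullet> x) / R\<^sup>2 \<le> 1" if "R > 0" "norm x \<le> R" for R and x :: 'a
    using that by (simp add: dot_square_norm power_mono)
  have sq2: "(x \<bullet> x) / R\<^sup>2 \<ge> 4" if "R > 0" "norm x \<ge> 2 * R" for R and x :: 'a
    using that power_mono[of "2 * R" "norm x" 2] by (simp add: dot_square_norm field_simps)
  have z: "\<phi> R x = 0" if "R > 0" "norm x \<ge> 2 * R" for R x
    using sq2[OF that] theta_0_mono[of 1 "(x \<bullet> x) / R\<^sup>2 - 1"] by (auto simp: \<phi>_def c_def intro: theta_nonpos)
  have sm: "smooth (\<phi> R)" for R
  proof -
    have "smooth (\<lambda>x::'a. inverse (R\<^sup>2) * (x \<bullet> x))" by (intro smooth_mult smooth_const smooth_inner_self)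
    then show ?thesis
      unfolding \<phi>_def divide_inverse by (subst mult.commute) (intro smooth_theta smooth_diff smooth_const)
  qed
  have gr: "grad (\<phi> R) x = (- 2 / R\<^sup>2 * d ((x \<bullet> x) / R\<^sup>2)) *\<^sub>R x" if "R > 0" for R x
  proof (rule grad_eqI)
    have th: "(theta n has_derivative (\<lambda>v. theta (Suc n) t * v)) (at t)" for n t
      using theta_has_derivative[of n t] by (simp add: has_field_derivative_def)
    note [derivative_intros] = has_derivative_compose[OF _ th]
    show "(\<phi> R has_derivative (\<lambda>v. ((- 2 / R\<^sup>2 * d ((x \<bullet> x) / R\<^sup>2)) *\<^sub>R x) \<bullet> v)) (at x)"
      unfolding \<phi>_def d_def
      using that by (auto intro!: derivative_eq_intros simp: inner_commute field_simps power2_eq_square)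
  qed
  have B': "norm (grad (\<phi> R) x) \<le> (4 * B) / R" if R: "R > 0" for R x
  proof (cases "(x \<bullet> x) / R\<^sup>2 \<in> {1..2}")
    case True
    have "norm x \<le> 2 * R"
      using True sq2[of R x] R by fastforce
    have "norm (grad (\<phi> R) x) = 2 / R\<^sup>2 * \<bar>d ((x \<bullet> x) / R\<^sup>2)\<bar> * norm x"
      by (simp add: gr[OF R] abs_mult)
    also have "\<dots> \<le> 2 / R\<^sup>2 * B * (2 * R)"
      using B[OF True] \<open>norm x \<le> 2 * R\<close> R by (intro mult_mono mult_nonneg_nonneg) auto
    also have "\<dots> = (4 * B) / R"
      using R by (simp add: power2_eq_square)
    finally show ?thesis .
  next
    case False
    then have "grad (\<phi> R) x = 0" unfolding gr[OF R] by (subst d0) auto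
    moreover have "B \<ge> 0" using B[of 1] by auto
    ultimately show ?thesis using R by simp
  qed
  show ?thesis
  proof (rule exI[of _ \<phi>], rule exI[of _ "theta 0 c"], rule exI[of _ "4 * B"], intro conjI[of "theta 0 c > 0"] allI[of "\<lambda>R. R > 0 \<longrightarrow> _ R"] impI)
    show "theta 0 c > 0" by (rule theta_0_pos[OF c])
    fix R :: real assume R: "R > 0"
    have "\<phi> R \<in> test_functions"
      using sm z[OF R] less_imp_le unfolding test_functions_iff by blast
    moreover have "0 \<le> \<phi> R x" "\<phi> R x \<le> 1" for x by (simp_all add: \<phi>_def theta_0_nonneg theta_0_le_1)
    moreover have "\<phi> R x = theta 0 c \<and> grad (\<phi> R) x = 0" if "norm x \<le> R" for x
      using sq[OF R that] unfolding gr[OF R] by (simp add: d0) (simp add: \<phi>_def theta_nonpos)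
    moreover have "\<phi> R x = 0 \<and> grad (\<phi> R) x = 0" if "norm x \<ge> 2 * R" for x
      using sq2[OF R that] z[OF R that] unfolding gr[OF R] by (subst d0) auto
    ultimately show "\<phi> R \<in> test_functions \<and> (\<forall>x. 0 \<le> \<phi> R x \<and> \<phi> R x \<le> 1 \<and> norm (grad (\<phi> R) x) \<le> 4 * B / R
      \<and> (norm x \<le> R \<longrightarrow> \<phi> R x = theta 0 c \<and> grad (\<phi> R) x = 0)
      \<and> (norm x \<ge> 2 * R \<longrightarrow> \<phi> R x = 0 \<and> grad (\<phi> R) x = 0))"
      using B'[OF R] by blast
  qed
qed

section \<open>Mollification\<close>

text \<open>
  The kernel is evaluated at \<open>y - x\<close>, not at \<open>x - y\<close>. In this form it is a translated test function of
  the integration variable, to which the definition of the weak gradient applies without a reflection.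
\<close>

definition mollify :: "('a::euclidean_space \<Rightarrow> real) \<Rightarrow> ('a \<Rightarrow> 'b::euclidean_space) \<Rightarrow> 'a \<Rightarrow> 'b" where
  "mollify \<kappa> f x = (LINT y|lborel. \<kappa> (y - x) *\<^sub>R f y)"

lemma integral_lborel_translate:
  fixes f :: "'a::euclidean_space \<Rightarrow> 'b::euclidean_space"
  assumes "f \<in> borel_measurable borel"
  shows "(LINT y|lborel. f y) = (LINT z|lborel. f (x + z))"
  using integral_distr[of "\<lambda>z. x + z" lborel borel f] assms by (simp add: lborel_distr_plus)

lemma nn_integral_lborel_translate:
  fixes f :: "'a::euclidean_space \<Rightarrow> ennreal"
  assumes "f \<in> borel_measurable borel"
  shows "(\<integral>\<^sup>+y. f y \<partial>lborel) = (\<integral>\<^sup>+z. f (x + z) \<partial>lborel)"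
  using nn_integral_distr[of "\<lambda>z. x + z" lborel borel f] assms by (simp add: lborel_distr_plus)

lemma integral_continuous_compact_support:
  fixes f :: "'a::euclidean_space \<Rightarrow> real"
  assumes "continuous_on (cbox a b) f" "\<And>x. x \<notin> cbox a b \<Longrightarrow> f x = 0"
  shows "(LINT x|lborel. f x) = integral (cbox a b) f"
proof -
  have "set_integrable lborel (cbox a b) f"
    unfolding set_integrable_def by (intro borel_integrable_compact assms) auto
  then have "(LINT x:cbox a b|lborel. f x) = integral (cbox a b) f"
    by (rule set_borel_integral_eq_integral)
  moreover have "(\<lambda>x. indicator (cbox a b) x *\<^sub>R f x) = f"
    using assms(2) by (auto simp: fun_eq_iff indicator_def)
  ultimately show ?thesis
    by (simp add: set_lebesgue_integral_def)
qed

lemma test_functionsD: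
  assumes "\<phi> \<in> test_functions"
  shows "smooth \<phi>" "\<exists>r. \<forall>x. norm x > r \<longrightarrow> \<phi> x = 0"
  using assms by (simp_all add: test_functions_iff)

lemma grad_eq_0_outside:
  fixes \<phi> :: "'a::euclidean_space \<Rightarrow> real"
  assumes "\<And>y. norm y > r \<Longrightarrow> \<phi> y = 0" "norm x > r"
  shows "grad \<phi> x = 0"
proof (rule grad_eqI)
  have op: "open {y::'a. norm y > r}"
    by (intro open_Collect_less continuous_intros)
  have "(\<phi> has_derivative (\<lambda>v. 0)) (at x)"
    by (rule has_derivative_transform_within_open[of "\<lambda>_. 0" "\<lambda>_. 0" x UNIV "{y. norm y > r}"]) (use assms op in auto)
  then show "(\<phi> has_derivative (\<lambda>v. 0 \<bullet> v)) (at x)" by simp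
qed

lemma test_function_grad_inner: "\<phi> \<in> test_functions \<Longrightarrow> (\<lambda>x. grad \<phi> x \<bullet> v) \<in> test_functions"
  unfolding test_functions_iff by (metis smooth_grad_inner grad_eq_0_outside inner_zero_left)

lemma test_function_mult: "smooth f \<Longrightarrow> \<phi> \<in> test_functions \<Longrightarrow> (\<lambda>x. f x * \<phi> x) \<in> test_functions"
  unfolding test_functions_iff by auto

lemma test_function_translate: "\<phi> \<in> test_functions \<Longrightarrow> (\<lambda>y. \<phi> (y - x)) \<in> test_functions"
proof -
  assume \<phi>: "\<phi> \<in> test_functions"
  then obtain r where r: "\<And>x. norm x > r \<Longrightarrow> \<phi> x = 0" by (auto simp: test_functions_iff)
  have "\<phi> (y - x) = 0" if "norm y > r + norm x" for y
    using that norm_triangle_ineq2[of y x] by (intro r) auto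
  then show ?thesis using \<phi> by (auto simp: test_functions_iff smooth_def intro: C_k_translate)
qed

lemma grad_translate:
  assumes "smooth \<phi>" shows "grad (\<lambda>y. \<phi> (y - x)) y = grad \<phi> (y - x)"
  by (rule grad_eqI, rule has_derivative_compose[where f = "\<lambda>y. y - x" and f' = "\<lambda>v. v", simplified])
    (auto intro!: derivative_eq_intros smooth_has_derivative_grad assms)

text \<open>
  Locally in \<open>x\<close> the integral runs over one fixed box, so the Leibniz rule for parameter integrals
  applies: \<open>u\<close> is continuous and all derivatives fall on the kernel.
\<close>

lemma mollify_has_derivative:
  fixes u :: "'a::euclidean_space \<Rightarrow> real"
  assumes \<kappa>: "\<kappa> \<in> test_functions" and u: "continuous_on UNIV u"
  shows "(mollify \<kappa> u has_derivative (\<lambda>v. - mollify (\<lambda>z. grad \<kappa> z \<bullet> v) u x)) (at x)"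
proof -
  obtain r where r: "\<And>x. norm x > r \<Longrightarrow> \<kappa> x = 0"
    using test_functionsD(2)[OF \<kappa>] by blast
  have sm: "smooth \<kappa>" using test_functionsD(1)[OF \<kappa>] .
  obtain a b where ab: "cball x (r + 1) \<subseteq> cbox a b"
    using bounded_subset_cbox_symmetric[OF bounded_cball] by metis
  have out: "norm (y - x') > r" if "y \<notin> cbox a b" "x' \<in> ball x 1" for y x'
  proof -
    have "y \<notin> cball x (r + 1)" using that(1) ab by blast
    then show ?thesis using that(2) dist_triangle[of x y x'] by (simp add: dist_norm norm_minus_commute)
  qed
  have cu: "continuous_on S u" for S using u continuous_on_subset by blast
  note [continuous_intros] = continuous_on_compose2[OF cu]
    continuous_on_compose2[OF smooth_continuous[OF sm, of UNIV]]
    continuous_on_compose2[OF smooth_grad_continuous[OF sm, of UNIV]]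
  define F where "F x' y = \<kappa> (y - x') * u y" for x' y
  \<comment> \<open>the derivative is written as a bounded linear function, as the Leibniz rule requires\<close>
  define F' where "F' x' y = (- u y) *\<^sub>R blinfun_inner_left (grad \<kappa> (y - x'))" for x' y
  have moll: "mollify \<kappa> u x' = integral (cbox a b) (F x')" if "x' \<in> ball x 1" for x'
    unfolding mollify_def F_def real_scaleR_def using that
    by (intro integral_continuous_compact_support) (auto intro!: continuous_intros r out)
  have contF': "continuous_on (ball x 1 \<times> cbox a b) (\<lambda>(x', y). F' x' y)"
    unfolding F'_def split_beta
    by (intro continuous_intros bounded_linear.continuous_on[OF bounded_linear_blinfun_inner_left]) auto
  have "((\<lambda>x'. integral (cbox a b) (F x')) has_derivative integral (cbox a b) (F' x)) (at x within ball x 1)"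
  proof (rule leibniz_rule)
    fix x' y
    have "((\<lambda>x'. \<kappa> (y - x')) has_derivative (\<lambda>v. grad \<kappa> (y - x') \<bullet> (- v))) (at x' within ball x 1)"
      by (rule has_derivative_compose[where f = "\<lambda>x. y - x" and f' = "\<lambda>v. - v"])
        (auto intro!: derivative_eq_intros smooth_has_derivative_grad[OF sm])
    then show "((\<lambda>x. F x y) has_derivative blinfun_apply (F' x' y)) (at x' within ball x 1)"
      unfolding F_def F'_def by (auto intro!: derivative_eq_intros simp: inner_commute blinfun.bilinear_simps)
  next
    fix x' show "F x' integrable_on cbox a b"
      unfolding F_def by (intro integrable_continuous continuous_intros) auto
  qed (use contF' in auto)
  then have "((\<lambda>x'. integral (cbox a b) (F x')) has_derivative integral (cbox a b) (F' x)) (at x)"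
    by (subst (asm) at_within_open) auto
  then have *: "(mollify \<kappa> u has_derivative integral (cbox a b) (F' x)) (at x)"
    by (rule has_derivative_transform_within_open[of _ _ _ _ "ball x 1"]) (auto simp: moll)
  have g0: "grad \<kappa> (y - x) = 0" if "y \<notin> cbox a b" for y
    using grad_eq_0_outside[of r \<kappa> "y - x"] r out[OF that, of x] by auto
  have "integral (cbox a b) (F' x) v = - mollify (\<lambda>z. grad \<kappa> z \<bullet> v) u x" for v
  proof -
    have "integral (cbox a b) (F' x) v = integral (cbox a b) (\<lambda>y. F' x y v)"
      unfolding F'_def
      by (intro blinfun_apply_integral integrable_continuous continuous_intros
          bounded_linear.continuous_on[OF bounded_linear_blinfun_inner_left]) auto
    also have "\<dots> = - integral (cbox a b) (\<lambda>y. (grad \<kappa> (y - x) \<bullet> v) * u y)"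
      by (subst Henstock_Kurzweil_Integration.integral_neg[symmetric]) (simp add: F'_def blinfun.bilinear_simps inner_commute mult.commute)
    also have "integral (cbox a b) (\<lambda>y. (grad \<kappa> (y - x) \<bullet> v) * u y) = mollify (\<lambda>z. grad \<kappa> z \<bullet> v) u x"
      unfolding mollify_def real_scaleR_def
      by (intro integral_continuous_compact_support[symmetric])
        (auto intro!: continuous_intros simp: g0)
    finally show ?thesis .
  qed
  then have "blinfun_apply (integral (cbox a b) (F' x)) = (\<lambda>v. - mollify (\<lambda>z. grad \<kappa> z \<bullet> v) u x)"
    by blast
  with * show ?thesis by simp
qed

text \<open>
  A partial derivative of a mollification is again a mollification, with minus a partial derivative of
  the kernel as its kernel.
\<close>

lemma smooth_mollify:
  fixes u :: "'a::euclidean_space \<Rightarrow> real"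
  assumes "\<kappa> \<in> test_functions" "continuous_on UNIV u"
  shows "smooth (mollify \<kappa> u)"
proof -
  have "C_k k (mollify \<kappa> u)" if "\<kappa> \<in> test_functions" for k \<kappa>
    using that
  proof (induction k arbitrary: \<kappa>)
    case 0
    then show ?case
      unfolding C_k.simps
      by (intro continuous_at_imp_continuous_on ballI has_derivative_continuous[OF mollify_has_derivative] assms(2))
  next
    case (Suc k)
    show ?case
    proof (intro C_k_SucI[where f' = "\<lambda>x v. - mollify (\<lambda>z. grad \<kappa> z \<bullet> v) u x"]
        mollify_has_derivative Suc.prems assms)
      fix b
      have "C_k k (\<lambda>x. (-1) * mollify (\<lambda>z. grad \<kappa> z \<bullet> b) u x)"
        by (intro C_k_mult C_k_const Suc.IH test_function_grad_inner Suc.prems)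
      then show "C_k k (\<lambda>x. - mollify (\<lambda>z. grad \<kappa> z \<bullet> b) u x)" by simp
    qed
  qed
  then show ?thesis using assms by (simp add: smooth_def)
qed

lemma mollify_shift:
  assumes "\<kappa> \<in> borel_measurable borel" "f \<in> borel_measurable borel"
  shows "mollify \<kappa> f x = (LINT z|lborel. \<kappa> z *\<^sub>R f (x + z))"
  unfolding mollify_def
  by (subst integral_lborel_translate[of _ x]) (use assms in \<open>auto simp: measurable_split_conv\<close>)

lemma integrable_mult_compact_support:
  fixes f :: "'a::euclidean_space \<Rightarrow> 'b::euclidean_space" and \<zeta> :: "'a \<Rightarrow> real"
  assumes \<zeta>: "continuous_on UNIV \<zeta>" "\<And>x. norm x > r \<Longrightarrow> \<zeta> x *\<^sub>R f x = 0"
    and f: "set_integrable lborel (cball 0 r) f"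
  shows "integrable lborel (\<lambda>x. \<zeta> x *\<^sub>R f x)"
proof -
  have "bounded (\<zeta> ` cball 0 r)"
    using \<zeta>(1) continuous_on_subset by (intro compact_imp_bounded compact_continuous_image) auto
  then obtain M where M: "\<And>x. norm x \<le> r \<Longrightarrow> norm (\<zeta> x) \<le> M"
    unfolding bounded_iff by (metis imageI mem_cball_0)
  have [measurable]: "\<zeta> \<in> borel_measurable borel"
    by (intro borel_measurable_continuous_onI \<zeta>)
  have f': "integrable lborel (\<lambda>x. indicator (cball 0 r) x *\<^sub>R f x)"
    using f by (simp add: set_integrable_def)
  have eq: "\<zeta> x *\<^sub>R f x = \<zeta> x *\<^sub>R (indicator (cball 0 r) x *\<^sub>R f x)" for x
    using \<zeta>(2)[of x] by (cases "norm x > r") (simp_all add: indicator_def)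
  show ?thesis unfolding eq
  proof (rule Bochner_Integration.integrable_bound)
    show "integrable lborel (\<lambda>x. M *\<^sub>R (indicator (cball 0 r) x *\<^sub>R f x))"
      using f' by (intro integrable_scaleR_right)
    show "(\<lambda>x. \<zeta> x *\<^sub>R (indicator (cball 0 r) x *\<^sub>R f x)) \<in> borel_measurable lborel"
      using borel_measurable_integrable[OF f'] by measurable
    show "AE x in lborel. norm (\<zeta> x *\<^sub>R (indicator (cball 0 r) x *\<^sub>R f x))
        \<le> norm (M *\<^sub>R (indicator (cball 0 r) x *\<^sub>R f x))"
    proof (intro AE_I2)
      fix x
      show "norm (\<zeta> x *\<^sub>R (indicator (cball 0 r) x *\<^sub>R f x))
        \<le> norm (M *\<^sub>R (indicator (cball 0 r) x *\<^sub>R f x))"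
        using M[of x] by (cases "norm x \<le> r") (auto intro!: mult_right_mono)
    qed
  qed
qed

lemma integrable_inner_compact_support:
  fixes A w :: "'a::euclidean_space \<Rightarrow> 'b::euclidean_space"
  assumes w: "continuous_on UNIV w" "\<And>x. norm x > r \<Longrightarrow> w x = 0"
    and A: "set_integrable lborel (cball 0 r) A"
  shows "integrable lborel (\<lambda>x. A x \<bullet> w x)"
proof -
  have "integrable lborel (\<lambda>x. \<Sum>b\<in>Basis. (w x \<bullet> b) *\<^sub>R (A x \<bullet> b))"
  proof (intro Bochner_Integration.integrable_sum integrable_mult_compact_support)
    fix b :: 'b
    show "set_integrable lborel (cball 0 r) (\<lambda>x. A x \<bullet> b)"
      using A integrable_inner_left[of b lborel "\<lambda>x. indicator (cball 0 r) x *\<^sub>R A x"]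
      by (simp add: set_integrable_def)
    show "continuous_on UNIV (\<lambda>x. w x \<bullet> b)"
      by (intro continuous_intros w)
  qed (simp add: w)
  also have "(\<lambda>x. \<Sum>b\<in>Basis. (w x \<bullet> b) *\<^sub>R (A x \<bullet> b)) = (\<lambda>x. A x \<bullet> w x)"
    by (subst (3) euclidean_inner) (simp add: mult.commute)
  finally show ?thesis .
qed

definition mollifier :: "real \<Rightarrow> ('a::euclidean_space \<Rightarrow> real) \<Rightarrow> bool" where
  "mollifier \<epsilon> \<kappa> \<longleftrightarrow> \<kappa> \<in> test_functions \<and> (\<forall>x. \<kappa> x \<ge> 0) \<and> (\<forall>x. norm x > \<epsilon> \<longrightarrow> \<kappa> x = 0)
     \<and> integrable lborel \<kappa> \<and> (LINT x|lborel. \<kappa> x) = 1"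

lemma test_function_integrable:
  assumes "\<phi> \<in> test_functions" shows "integrable lborel \<phi>"
proof -
  obtain r where r: "\<And>x. norm x > r \<Longrightarrow> \<phi> x = 0"
    using test_functionsD(2)[OF assms] by blast
  have "integrable lborel (\<lambda>x. indicator (cball 0 r) x *\<^sub>R \<phi> x)"
    by (intro borel_integrable_compact smooth_continuous test_functionsD(1)[OF assms]) auto
  moreover have "(\<lambda>x. indicator (cball 0 r) x *\<^sub>R \<phi> x) = \<phi>"
    using r by (auto simp: indicator_def fun_eq_iff)
  ultimately show ?thesis by simp
qed

lemma mollifier_exists:
  assumes "\<epsilon> > 0" obtains \<kappa> :: "'a::euclidean_space \<Rightarrow> real" where "mollifier \<epsilon> \<kappa>"
proof (rule test_function_bump[OF assms, where 'a = 'a])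
  fix \<eta> :: "'a \<Rightarrow> real"
  assume \<eta>: "\<eta> \<in> test_functions" "\<And>x. \<eta> x \<ge> 0"
    "\<And>x. norm x \<ge> \<epsilon> \<Longrightarrow> \<eta> x = 0" "\<And>x. norm x < \<epsilon> \<Longrightarrow> \<eta> x > 0"
  have int: "integrable lborel \<eta>" by (rule test_function_integrable) fact
  define I where "I = (LINT x|lborel. \<eta> x)"
  have "I \<noteq> 0"
  proof
    assume "I = 0"
    then have "AE x in lborel. \<eta> x = 0"
      using integral_nonneg_eq_0_iff_AE[OF int] \<eta>(2) by (simp add: I_def)
    then have "AE x in lborel. x \<notin> ball (0::'a) \<epsilon>"
      by (rule AE_mp) (use \<eta>(4) in force)
    then have "emeasure lborel (ball (0::'a) \<epsilon>) = 0"
      by (subst (asm) AE_iff_measurable[of "ball 0 \<epsilon>"]) auto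
    then show False
      using assms unit_ball_vol_pos[of "real DIM('a)"] by (simp add: emeasure_ball)
  qed
  moreover have "I \<ge> 0" unfolding I_def using \<eta>(2) by (intro integral_nonneg_AE) auto
  ultimately have "I > 0" by simp
  have "mollifier \<epsilon> (\<lambda>x. inverse I * \<eta> x)"
    unfolding mollifier_def using \<eta> int \<open>I > 0\<close>
    by (auto intro!: test_function_mult simp: I_def[symmetric])
  then show thesis by (rule that)
qed

lemma mollifier_nn_integral:
  assumes "mollifier \<epsilon> \<kappa>" shows "(\<integral>\<^sup>+x. ennreal (\<kappa> x) \<partial>lborel) = 1"
  using assms unfolding mollifier_def by (subst nn_integral_eq_integral) auto

lemma mollifier_measurable: "mollifier \<epsilon> \<kappa> \<Longrightarrow> \<kappa> \<in> borel_measurable borel"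
  unfolding mollifier_def using borel_measurable_integrable by force

lemma mollify_nonneg:
  fixes u :: "'a::euclidean_space \<Rightarrow> real"
  assumes "mollifier \<epsilon> \<kappa>" "\<And>x. u x \<ge> 0" shows "mollify \<kappa> u x \<ge> 0"
  using assms unfolding mollify_def mollifier_def by (intro integral_nonneg_AE) auto

text \<open>
  The kernel has integral \<open>1\<close>, so the difference is an average of the differences \<open>f (x + z) - f x\<close>.
  The bound is stated as an upper integral so that Tonelli's theorem applies to it directly.
\<close>

lemma mollify_diff_bound:
  fixes f :: "'a::euclidean_space \<Rightarrow> 'b::euclidean_space"
  assumes \<kappa>: "mollifier \<epsilon> \<kappa>" and [measurable]: "f \<in> borel_measurable borel"
    and loc: "\<And>r. set_integrable lborel (cball 0 r) f"
  shows "ennreal (norm (mollify \<kappa> f x - f x)) \<le> (\<integral>\<^sup>+z. ennreal (\<kappa> z * norm (f (x + z) - f x)) \<partial>lborel)"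
proof -
  note [measurable] = mollifier_measurable[OF \<kappa>]
  have \<kappa>': "smooth \<kappa>" "\<And>z. \<kappa> z \<ge> 0" "\<And>z. norm z > \<epsilon> \<Longrightarrow> \<kappa> z = 0" "integrable lborel \<kappa>" "(LINT z|lborel. \<kappa> z) = 1"
    using \<kappa> by (auto simp: mollifier_def test_functions_iff)
  have \<kappa>x: "(\<lambda>y. \<kappa> (y - x)) \<in> test_functions"
    using \<kappa> by (intro test_function_translate) (simp add: mollifier_def)
  obtain r where "\<And>y. norm y > r \<Longrightarrow> \<kappa> (y - x) = 0"
    using test_functionsD(2)[OF \<kappa>x] by blast
  then have "integrable lborel (\<lambda>y. \<kappa> (y - x) *\<^sub>R f y)"
    by (intro integrable_mult_compact_support loc smooth_continuous test_functionsD(1)[OF \<kappa>x]) auto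
  then have "integrable lborel (\<lambda>z. \<kappa> z *\<^sub>R f (x + z))"
    using integrable_distr_eq[of "\<lambda>z. x + z" lborel borel "\<lambda>y. \<kappa> (y - x) *\<^sub>R f y"]
    by (simp add: lborel_distr_plus)
  then have "mollify \<kappa> f x - f x = (LINT z|lborel. \<kappa> z *\<^sub>R f (x + z) - \<kappa> z *\<^sub>R f x)"
    using \<kappa>' by (subst Bochner_Integration.integral_diff) (auto simp: mollify_shift)
  also have "\<dots> = (LINT z|lborel. \<kappa> z *\<^sub>R (f (x + z) - f x))"
    by (simp add: scaleR_diff_right)
  finally have "norm (mollify \<kappa> f x - f x) = norm (LINT z|lborel. \<kappa> z *\<^sub>R (f (x + z) - f x))" by simp
  moreover have "integrable lborel (\<lambda>z. \<kappa> z *\<^sub>R (f (x + z) - f x))"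
    using \<open>integrable lborel (\<lambda>z. \<kappa> z *\<^sub>R f (x + z))\<close> \<kappa>' by (auto simp: scaleR_diff_right)
  ultimately show ?thesis
    using integral_norm_bound_ennreal[of lborel "\<lambda>z. \<kappa> z *\<^sub>R (f (x + z) - f x)"] \<kappa>'(2) by simp
qed

lemma continuous_set_integrable:
  fixes u :: "'a::euclidean_space \<Rightarrow> 'b::euclidean_space"
  assumes "continuous_on UNIV u" "compact K" shows "set_integrable lborel K u"
  unfolding set_integrable_def
  using assms continuous_on_subset by (intro borel_integrable_compact) blast+

lemma mollify_uniform_limit:
  fixes u :: "'a::euclidean_space \<Rightarrow> real"
  assumes u: "continuous_on UNIV u" and \<kappa>: "\<And>n. mollifier (inverse (real (Suc n))) (\<kappa> n)"
  shows "uniform_limit (cball 0 r) (\<lambda>n. mollify (\<kappa> n) u) u sequentially"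
proof (rule uniform_limitI)
  fix \<delta> :: real assume "\<delta> > 0"
  have "uniformly_continuous_on (cball 0 (r + 1)) u"
    using u continuous_on_subset by (intro compact_uniformly_continuous) auto
  then obtain d where d: "d > 0" "\<And>x y. x \<in> cball 0 (r + 1) \<Longrightarrow> y \<in> cball 0 (r + 1) \<Longrightarrow> dist y x < d \<Longrightarrow> dist (u y) (u x) < \<delta> / 2"
    using \<open>\<delta> > 0\<close> unfolding uniformly_continuous_on_def by (metis half_gt_zero)
  have "eventually (\<lambda>n. inverse (real (Suc n)) < d) sequentially"
    using LIMSEQ_inverse_real_of_nat d(1) by (rule order_tendstoD)
  then show "eventually (\<lambda>n. \<forall>x\<in>cball 0 r. dist (mollify (\<kappa> n) u x) (u x) < \<delta>) sequentially"
  proof (rule eventually_mono, intro ballI)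
    fix n and x :: 'a assume n: "inverse (real (Suc n)) < d" and x: "x \<in> cball 0 r"
    have "ennreal (norm (mollify (\<kappa> n) u x - u x)) \<le> (\<integral>\<^sup>+z. ennreal (\<kappa> n z * norm (u (x + z) - u x)) \<partial>lborel)"
      using u by (intro mollify_diff_bound[OF \<kappa>] borel_measurable_continuous_onI continuous_set_integrable) auto
    also have "\<dots> \<le> (\<integral>\<^sup>+z. ennreal (\<kappa> n z) * ennreal (\<delta> / 2) \<partial>lborel)"
    proof (intro nn_integral_mono)
      fix z
      have "\<kappa> n z * norm (u (x + z) - u x) \<le> \<kappa> n z * (\<delta> / 2)"
      proof (cases "norm z \<le> inverse (real (Suc n))")
        case True
        have "inverse (real (Suc n)) \<le> 1" by (simp add: field_simps)
        then have "norm (x + z) \<le> r + 1" using True x norm_triangle_ineq[of x z] by simp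
        then have "norm (u (x + z) - u x) \<le> \<delta> / 2"
          using less_imp_le[OF d(2)[of x "x + z"]] x True n by (simp add: dist_norm del: mem_cball)
        then show ?thesis using \<kappa>[of n] by (intro mult_left_mono) (auto simp: mollifier_def)
      next
        case False
        then have "\<kappa> n z = 0" using \<kappa>[of n] by (auto simp: mollifier_def)
        then show ?thesis by simp
      qed
      then show "ennreal (\<kappa> n z * norm (u (x + z) - u x)) \<le> ennreal (\<kappa> n z) * ennreal (\<delta> / 2)"
        using \<open>\<delta> > 0\<close> by (subst ennreal_mult''[symmetric]) (auto intro: ennreal_leI)
    qed
    also have "\<dots> = ennreal (\<delta> / 2)"
      using mollifier_measurable[OF \<kappa>[of n]] by (subst nn_integral_multc) (auto simp: mollifier_nn_integral[OF \<kappa>])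
    finally show "dist (mollify (\<kappa> n) u x) (u x) < \<delta>"
      using \<open>\<delta> > 0\<close> by (auto simp: dist_norm ennreal_le_iff)
  qed
qed

section \<open>Continuity of translations and convergence of mollified gradients\<close>

lemma cball_borel [measurable]: "cball x r \<in> sets borel"
  by simp

text \<open>
  A form of Young's inequality without conjugate exponents. If \<open>y \<le> \<eta> * x\<close>, the first term on the right
  is already large enough; otherwise \<open>x < y / \<eta>\<close>, and the second one is.
\<close>

lemma young_cases:
  fixes x y \<eta> p :: real
  assumes "x \<ge> 0" "y \<ge> 0" "\<eta> > 0" "p > 1"
  shows "x powr (p - 1) * y \<le> \<eta> * x powr p + \<eta> powr (1 - p) * y powr p"
proof (cases "y \<le> \<eta> * x")
  case True
  have "x powr (p - 1) * y \<le> x powr (p - 1) * (\<eta> * x)"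
    using True by (intro mult_left_mono) auto
  also have "\<dots> = \<eta> * x powr p"
    using assms by (cases "x = 0") (auto simp: powr_diff)
  finally show ?thesis by (simp add: add_increasing2)
next
  case False
  then have y: "y > 0" "x \<le> y / \<eta>" using assms by (auto simp: field_simps intro: le_less_trans[of 0 "\<eta> * x"])
  have "x powr (p - 1) * y \<le> (y / \<eta>) powr (p - 1) * y"
    using y assms by (intro mult_right_mono powr_mono2) auto
  also have "\<dots> = \<eta> powr (1 - p) * y powr p"
    using y assms by (simp add: powr_divide powr_diff)
  finally show ?thesis using assms by (simp add: add_increasing)
qed

lemma powr_sum_bound:
  fixes a b c p :: real
  assumes "a \<ge> 0" "b \<ge> 0" "c \<ge> 0" "p > 1"
  shows "(a + b + c) powr p \<le> 3 powr p * (a powr p + b powr p + c powr p)"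
proof -
  define m where "m = max a (max b c)"
  have "(a + b + c) powr p \<le> (3 * m) powr p"
    using assms by (intro powr_mono2) (auto simp: m_def)
  also have "\<dots> = 3 powr p * m powr p"
    using assms by (simp add: powr_mult m_def)
  also have "m powr p \<le> a powr p + b powr p + c powr p"
    unfolding m_def max_def by auto
  finally show ?thesis by simp
qed

text \<open>
  The truncation error is dominated by \<open>|G|\<close> and vanishes at each point for large \<open>n\<close>.
\<close>

lemma Lp_truncate:
  fixes G :: "'a::euclidean_space \<Rightarrow> 'b::euclidean_space"
  assumes p: "p > 1" and [measurable]: "G \<in> borel_measurable borel" "K \<in> sets borel"
    and fin: "(\<integral>\<^sup>+x\<in>K. ennreal (norm (G x) powr p) \<partial>lborel) < \<infinity>" and "\<delta> > 0"
  obtains n :: nat where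
    "(\<integral>\<^sup>+x\<in>K. ennreal (norm (closest_point (cball 0 (real n)) (G x) - G x) powr p) \<partial>lborel) < \<delta>"
proof -
  let ?c = "\<lambda>n. closest_point (cball 0 (real n)) :: 'b \<Rightarrow> 'b"
  have [measurable]: "?c n \<in> borel_measurable borel" for n
    by (intro borel_measurable_continuous_onI continuous_on_closest_point) auto
  have "(\<lambda>n. \<integral>\<^sup>+x\<in>K. ennreal (norm (?c n (G x) - G x) powr p) \<partial>lborel) \<longlonglongrightarrow> (\<integral>\<^sup>+x. 0 \<partial>(lborel :: 'a measure))"
  proof (rule nn_integral_dominated_convergence[where w = "\<lambda>x. ennreal (norm (G x) powr p) * indicator K x"])
    fix n
    have "norm (?c n y - y) \<le> norm y" for y
      using closest_point_le[of "cball 0 (real n)" 0 y] by (simp add: dist_norm norm_minus_commute)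
    then show "AE x in lborel. ennreal (norm (?c n (G x) - G x) powr p) * indicator K x
        \<le> ennreal (norm (G x) powr p) * indicator K x"
      using p by (intro AE_I2 mult_right_mono ennreal_leI powr_mono2) auto
  next
    have "eventually (\<lambda>n. ennreal (norm (?c n (G x) - G x) powr p) * indicator K x = 0) sequentially" for x
    proof -
      obtain N :: nat where "norm (G x) \<le> real N" using real_arch_simple by blast
      then have "ennreal (norm (?c n (G x) - G x) powr p) * indicator K x = 0" if "n \<ge> N" for n
        using that p by (subst closest_point_self) auto
      then show ?thesis by (auto simp: eventually_sequentially)
    qed
    then show "AE x in lborel. (\<lambda>n. ennreal (norm (?c n (G x) - G x) powr p) * indicator K x) \<longlonglongrightarrow> 0"
      by (intro AE_I2 tendsto_eventually)
  qed (use fin in auto)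
  then have "eventually (\<lambda>n. (\<integral>\<^sup>+x\<in>K. ennreal (norm (?c n (G x) - G x) powr p) \<partial>lborel) < \<delta>) sequentially"
    using \<open>\<delta> > 0\<close> by (auto intro: order_tendstoD)
  then show thesis using that by (auto simp: eventually_sequentially)
qed

text \<open>
  A measurable function is almost everywhere the limit of continuous functions. The projection onto a
  ball keeps these uniformly bounded, so dominated convergence gives convergence in the mean of order \<open>p\<close>.
\<close>

lemma Lp_continuous_approx_bounded:
  fixes G :: "'a::euclidean_space \<Rightarrow> 'b::euclidean_space"
  assumes p: "p > 1" and G[measurable]: "G \<in> borel_measurable borel" and K[measurable]: "K \<in> sets borel"
    and fin: "emeasure lborel K < \<infinity>" and "\<delta> > 0"
  obtains g where "continuous_on UNIV g"
    "(\<integral>\<^sup>+x\<in>K. ennreal (norm (g x - closest_point (cball 0 (real n)) (G x)) powr p) \<partial>lborel) < \<delta>"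
proof -
  define c :: "'b \<Rightarrow> 'b" where "c = closest_point (cball 0 (real n))"
  have contc: "continuous_on S c" for S
    unfolding c_def by (intro continuous_on_closest_point) auto
  have [measurable]: "c \<in> borel_measurable borel"
    by (intro borel_measurable_continuous_onI contc)
  have c: "norm (c y) \<le> n" for y
    using closest_point_in_set[of "cball 0 (real n)" y] by (auto simp: c_def)
  have "G \<in> borel_measurable lebesgue"
    by (intro measurable_completion) (simp add: G)
  then have "G measurable_on UNIV"
    by (rule lebesgue_measurable_imp_measurable_on) auto
  then obtain N g where N: "negligible N" and g: "\<And>k::nat. continuous_on UNIV (g k)"
    and lim: "\<And>x. x \<notin> N \<Longrightarrow> (\<lambda>k. g k x) \<longlonglongrightarrow> G x"
    unfolding measurable_on_def by auto
  have cg: "continuous_on UNIV (\<lambda>x. c (g k x))" for k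
    by (intro continuous_on_compose2[OF contc[of UNIV]] g) auto
  have [measurable]: "(\<lambda>x. c (g k x)) \<in> borel_measurable borel" for k
    by (intro borel_measurable_continuous_onI cg)
  have AE: "AE x in lborel. x \<notin> N"
  proof -
    have "AE x in lebesgue. x \<notin> N"
      using N by (simp add: negligible_iff_null_sets AE_not_in)
    then show ?thesis by (simp add: AE_completion_iff)
  qed
  have "(\<lambda>k. \<integral>\<^sup>+x\<in>K. ennreal (norm (c (g k x) - c (G x)) powr p) \<partial>lborel) \<longlonglongrightarrow> (\<integral>\<^sup>+x. 0 \<partial>(lborel :: 'a measure))"
  proof (rule nn_integral_dominated_convergence[where w = "\<lambda>x. ennreal ((2 * real n) powr p) * indicator K x"])
    fix k
    have "norm (c x - c y) \<le> 2 * real n" for x y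
      using c[of x] c[of y] norm_triangle_ineq4[of "c x" "c y"] by simp
    then show "AE x in lborel. ennreal (norm (c (g k x) - c (G x)) powr p) * indicator K x
        \<le> ennreal ((2 * real n) powr p) * indicator K x"
      using p by (intro AE_I2 mult_right_mono ennreal_leI powr_mono2) auto
  next
    have "(\<lambda>k. ennreal (norm (c (g k x) - c (G x)) powr p) * indicator K x) \<longlonglongrightarrow> 0" if "x \<notin> N" for x
    proof -
      have "(\<lambda>k. c (g k x)) \<longlonglongrightarrow> c (G x)"
        using lim[OF that] continuous_on_tendsto_compose[OF contc[of UNIV]] by auto
      then have "(\<lambda>k. norm (c (g k x) - c (G x))) \<longlonglongrightarrow> 0"
        by (simp add: LIM_zero_iff tendsto_norm_zero_iff)
      then have "(\<lambda>k. norm (c (g k x) - c (G x)) powr p) \<longlonglongrightarrow> 0"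
        using p by (intro tendsto_zero_powrI[where b = p]) auto
      then have "(\<lambda>k. ennreal (norm (c (g k x) - c (G x)) powr p)) \<longlonglongrightarrow> ennreal 0"
        by (rule tendsto_ennrealI)
      then show ?thesis by (cases "x \<in> K") auto
    qed
    then show "AE x in lborel. (\<lambda>k. ennreal (norm (c (g k x) - c (G x)) powr p) * indicator K x) \<longlonglongrightarrow> 0"
      using AE by auto
  next
    show "(\<integral>\<^sup>+x\<in>K. ennreal ((2 * real n) powr p) \<partial>lborel) < \<infinity>"
      using fin by (simp add: nn_integral_cmult ennreal_mult_less_top)
  qed auto
  then have "eventually (\<lambda>k. (\<integral>\<^sup>+x\<in>K. ennreal (norm (c (g k x) - c (G x)) powr p) \<partial>lborel) < \<delta>) sequentially"
    using \<open>\<delta> > 0\<close> by (auto intro: order_tendstoD)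
  then show thesis using that[OF cg] by (auto simp: eventually_sequentially c_def)
qed

lemma nn_integral_powr_sum_bound:
  fixes a b c :: "'a::euclidean_space \<Rightarrow> real"
  assumes p: "p > 1" and [measurable]: "a \<in> borel_measurable borel" "b \<in> borel_measurable borel"
    "c \<in> borel_measurable borel" "d \<in> borel_measurable borel" "K \<in> sets borel"
    and nonneg: "\<And>x. a x \<ge> 0" "\<And>x. b x \<ge> 0" "\<And>x. c x \<ge> 0" "\<And>x. d x \<ge> 0"
    and le: "\<And>x. d x \<le> a x + b x + c x"
  shows "(\<integral>\<^sup>+x\<in>K. ennreal (d x powr p) \<partial>lborel) \<le> ennreal (3 powr p) *
    ((\<integral>\<^sup>+x\<in>K. ennreal (a x powr p) \<partial>lborel) + (\<integral>\<^sup>+x\<in>K. ennreal (b x powr p) \<partial>lborel)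
      + (\<integral>\<^sup>+x\<in>K. ennreal (c x powr p) \<partial>lborel))"
proof -
  have "ennreal (d x powr p) * indicator K x \<le> ennreal (3 powr p) * (ennreal (a x powr p) * indicator K x
      + ennreal (b x powr p) * indicator K x + ennreal (c x powr p) * indicator K x)" for x
  proof -
    have "d x powr p \<le> (a x + b x + c x) powr p"
      using p nonneg le by (intro powr_mono2) auto
    also have "\<dots> \<le> 3 powr p * (a x powr p + b x powr p + c x powr p)"
      by (intro powr_sum_bound p nonneg)
    finally have "ennreal (d x powr p) \<le> ennreal (3 powr p) * (ennreal (a x powr p) + ennreal (b x powr p) + ennreal (c x powr p))"
      by (simp add: ennreal_mult'[symmetric] ennreal_plus[symmetric] del: ennreal_plus)
    then show ?thesis by (auto simp: indicator_def)
  qed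
  then have "(\<integral>\<^sup>+x\<in>K. ennreal (d x powr p) \<partial>lborel) \<le> (\<integral>\<^sup>+x. ennreal (3 powr p) * (ennreal (a x powr p) * indicator K x
      + ennreal (b x powr p) * indicator K x + ennreal (c x powr p) * indicator K x) \<partial>lborel)"
    by (intro nn_integral_mono) auto
  then show ?thesis by (simp add: nn_integral_cmult nn_integral_add)
qed

lemma Lp_continuous_approx:
  fixes G :: "'a::euclidean_space \<Rightarrow> 'b::euclidean_space"
  assumes p: "p > 1" and [measurable]: "G \<in> borel_measurable borel" and [measurable]: "K \<in> sets borel"
    and fin: "emeasure lborel K < \<infinity>" "(\<integral>\<^sup>+x\<in>K. ennreal (norm (G x) powr p) \<partial>lborel) < \<infinity>"
    and "\<delta> > 0"
  obtains g where "continuous_on UNIV g" "(\<integral>\<^sup>+x\<in>K. ennreal (norm (G x - g x) powr p) \<partial>lborel) \<le> ennreal \<delta>"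
proof -
  define e where "e = \<delta> / (2 * 3 powr p)"
  have "ennreal e > 0" using \<open>\<delta> > 0\<close> by (simp add: e_def)
  obtain n :: nat where n: "(\<integral>\<^sup>+x\<in>K. ennreal (norm (closest_point (cball 0 (real n)) (G x) - G x) powr p) \<partial>lborel) < ennreal e"
    by (rule Lp_truncate[OF p _ _ fin(2) \<open>ennreal e > 0\<close>]) auto
  obtain g where g: "continuous_on UNIV g"
    "(\<integral>\<^sup>+x\<in>K. ennreal (norm (g x - closest_point (cball 0 (real n)) (G x)) powr p) \<partial>lborel) < ennreal e"
    by (rule Lp_continuous_approx_bounded[OF p _ _ fin(1) \<open>ennreal e > 0\<close>, of G n]) auto
  have [measurable]: "g \<in> borel_measurable borel" by (intro borel_measurable_continuous_onI g)
  let ?c = "closest_point (cball 0 (real n)) :: 'b \<Rightarrow> 'b"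
  have [measurable]: "?c \<in> borel_measurable borel"
    by (intro borel_measurable_continuous_onI continuous_on_closest_point) auto
  have "(\<integral>\<^sup>+x\<in>K. ennreal (norm (G x - g x) powr p) \<partial>lborel) \<le> ennreal (3 powr p) *
    ((\<integral>\<^sup>+x\<in>K. ennreal (norm (?c (G x) - G x) powr p) \<partial>lborel)
     + (\<integral>\<^sup>+x\<in>K. ennreal (norm (g x - ?c (G x)) powr p) \<partial>lborel) + (\<integral>\<^sup>+x\<in>K. ennreal (0 powr p) \<partial>lborel))"
  proof (rule nn_integral_powr_sum_bound[OF p])
    fix x show "norm (G x - g x) \<le> norm (?c (G x) - G x) + norm (g x - ?c (G x)) + 0"
      using norm_triangle_ineq[of "?c (G x) - G x" "g x - ?c (G x)"] by (simp add: norm_minus_commute)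
  qed auto
  also have "\<dots> \<le> ennreal (3 powr p) * (ennreal e + ennreal e + 0)"
    by (intro mult_left_mono add_mono less_imp_le[OF n] less_imp_le[OF g(2)]) auto
  also have "\<dots> = ennreal \<delta>"
    using \<open>\<delta> > 0\<close> by (simp add: ennreal_mult'[symmetric] ennreal_plus[symmetric] e_def del: ennreal_plus)
  finally show thesis using that g(1) by blast
qed

text \<open>
  For a continuous function \<open>g\<close> near \<open>G\<close> the claim is uniform continuity, and the two error terms
  \<open>G (x + z) - g (x + z)\<close> and \<open>G x - g x\<close> are controlled by the translation invariance of the measure.
\<close>

lemma Lp_translate_continuous:
  fixes G :: "'a::euclidean_space \<Rightarrow> 'b::euclidean_space"
  assumes p: "p > 1" and [measurable]: "G \<in> borel_measurable borel"
    and fin: "\<And>r. (\<integral>\<^sup>+x\<in>cball 0 r. ennreal (norm (G x) powr p) \<partial>lborel) < \<infinity>"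
    and "\<delta> > 0"
  obtains \<epsilon> where "\<epsilon> > 0"
    "\<And>z. norm z \<le> \<epsilon> \<Longrightarrow> (\<integral>\<^sup>+x\<in>cball 0 r. ennreal (norm (G (x + z) - G x) powr p) \<partial>lborel) \<le> ennreal \<delta>"
proof -
  define e where "e = \<delta> / (3 * 3 powr p)"
  have "e > 0" using \<open>\<delta> > 0\<close> by (simp add: e_def)
  have fin_cball: "emeasure lborel (cball (0::'a) s) < \<infinity>" for s
    by (intro emeasure_bounded_finite) auto
  obtain g where g: "continuous_on UNIV g"
    "(\<integral>\<^sup>+x\<in>cball 0 (r + 1). ennreal (norm (G x - g x) powr p) \<partial>lborel) \<le> ennreal e"
    by (rule Lp_continuous_approx[OF p _ _ fin_cball fin \<open>e > 0\<close>]) auto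
  have [measurable]: "g \<in> borel_measurable borel" by (intro borel_measurable_continuous_onI g)
  define V where "V = measure lborel (cball (0::'a) r)"
  \<comment> \<open>chosen such that \<open>s powr p\<close> integrates to at most \<open>e\<close> over the ball\<close>
  define s where "s = (e / (V + 1)) powr inverse p"
  have "V \<ge> 0" by (simp add: V_def)
  then have "s > 0" using \<open>e > 0\<close> by (simp add: s_def)
  have "uniformly_continuous_on (cball 0 (r + 1)) g"
    using g(1) continuous_on_subset by (intro compact_uniformly_continuous) auto
  then obtain d where d: "d > 0" "\<And>x y. x \<in> cball 0 (r + 1) \<Longrightarrow> y \<in> cball 0 (r + 1) \<Longrightarrow> dist y x < d \<Longrightarrow> dist (g y) (g x) < s"
    using \<open>s > 0\<close> unfolding uniformly_continuous_on_def by metis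
  show thesis
  proof (rule that[of "min 1 (d / 2)"])
    show "min 1 (d / 2) > 0" using d(1) by simp
    fix z :: 'a assume z: "norm z \<le> min 1 (d / 2)"
    have "(\<integral>\<^sup>+x\<in>cball 0 r. ennreal (norm (G (x + z) - G x) powr p) \<partial>lborel) \<le> ennreal (3 powr p) *
      ((\<integral>\<^sup>+x\<in>cball 0 r. ennreal (norm (G (x + z) - g (x + z)) powr p) \<partial>lborel)
       + (\<integral>\<^sup>+x\<in>cball 0 r. ennreal (norm (g (x + z) - g x) powr p) \<partial>lborel)
       + (\<integral>\<^sup>+x\<in>cball 0 r. ennreal (norm (G x - g x) powr p) \<partial>lborel))"
    proof (rule nn_integral_powr_sum_bound[OF p])
      fix x show "norm (G (x + z) - G x) \<le> norm (G (x + z) - g (x + z)) + norm (g (x + z) - g x) + norm (G x - g x)"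
        using norm_triangle_ineq[of "(G (x + z) - g (x + z)) + (g (x + z) - g x)" "g x - G x"]
          norm_triangle_ineq[of "G (x + z) - g (x + z)" "g (x + z) - g x"]
        by (simp add: norm_minus_commute)
    qed auto
    also have "\<dots> \<le> ennreal (3 powr p) * (ennreal e + ennreal e + ennreal e)"
    proof (intro mult_left_mono add_mono)
      have "(\<integral>\<^sup>+x\<in>cball 0 r. ennreal (norm (G (x + z) - g (x + z)) powr p) \<partial>lborel)
          \<le> (\<integral>\<^sup>+x. ennreal (norm (G (z + x) - g (z + x)) powr p) * indicator (cball 0 (r + 1)) (z + x) \<partial>lborel)"
      proof (intro nn_integral_mono)
        fix x
        have "norm (z + x) \<le> r + 1" if "norm x \<le> r"
          using that z norm_triangle_ineq[of z x] by simp
        then show "ennreal (norm (G (x + z) - g (x + z)) powr p) * indicator (cball 0 r) x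
            \<le> ennreal (norm (G (z + x) - g (z + x)) powr p) * indicator (cball 0 (r + 1)) (z + x)"
          by (auto simp: indicator_def add.commute)
      qed
      also have "\<dots> = (\<integral>\<^sup>+x\<in>cball 0 (r + 1). ennreal (norm (G x - g x) powr p) \<partial>lborel)"
        by (rule nn_integral_lborel_translate[symmetric]) auto
      finally show "(\<integral>\<^sup>+x\<in>cball 0 r. ennreal (norm (G (x + z) - g (x + z)) powr p) \<partial>lborel) \<le> ennreal e"
        using g(2) by (rule order_trans)
      have "(\<integral>\<^sup>+x\<in>cball 0 r. ennreal (norm (G x - g x) powr p) \<partial>lborel)
          \<le> (\<integral>\<^sup>+x\<in>cball 0 (r + 1). ennreal (norm (G x - g x) powr p) \<partial>lborel)"
        by (intro nn_integral_mono) (auto simp: indicator_def)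
      then show "(\<integral>\<^sup>+x\<in>cball 0 r. ennreal (norm (G x - g x) powr p) \<partial>lborel) \<le> ennreal e"
        using g(2) by (rule order_trans)
      have "(\<integral>\<^sup>+x\<in>cball 0 r. ennreal (norm (g (x + z) - g x) powr p) \<partial>lborel)
          \<le> (\<integral>\<^sup>+x\<in>cball (0::'a) r. ennreal (e / (V + 1)) \<partial>lborel)"
      proof (intro nn_integral_mono)
        fix x :: 'a
        have "norm (g (x + z) - g x) powr p \<le> e / (V + 1)" if "norm x \<le> r"
        proof -
          have "norm (x + z) \<le> r + 1" using that z norm_triangle_ineq[of x z] by simp
          then have "dist (g (x + z)) (g x) < s"
            using that z d(1) by (intro d(2)) (auto simp: dist_norm[of "x + z" x])
          then have "norm (g (x + z) - g x) powr p \<le> s powr p"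
            using p by (intro powr_mono2) (auto simp: dist_norm)
          also have "\<dots> = e / (V + 1)"
            using p \<open>e > 0\<close> \<open>V \<ge> 0\<close> by (simp add: s_def powr_powr)
          finally show ?thesis .
        qed
        then show "ennreal (norm (g (x + z) - g x) powr p) * indicator (cball 0 r) x
            \<le> ennreal (e / (V + 1)) * indicator (cball 0 r) x"
          by (auto simp: indicator_def intro: ennreal_leI)
      qed
      also have "\<dots> = ennreal (e / (V + 1)) * ennreal V"
        using fin_cball[of r] by (simp add: nn_integral_cmult V_def emeasure_eq_ennreal_measure)
      also have "\<dots> \<le> ennreal e"
        using \<open>e > 0\<close> \<open>V \<ge> 0\<close> by (subst ennreal_mult'[symmetric]) (auto intro!: ennreal_leI simp: field_simps)
      finally show "(\<integral>\<^sup>+x\<in>cball 0 r. ennreal (norm (g (x + z) - g x) powr p) \<partial>lborel) \<le> ennreal e" .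
    qed auto
    also have "\<dots> = ennreal \<delta>"
      using \<open>\<delta> > 0\<close> by (simp add: ennreal_mult'[symmetric] ennreal_plus[symmetric] e_def del: ennreal_plus)
    finally show "(\<integral>\<^sup>+x\<in>cball 0 r. ennreal (norm (G (x + z) - G x) powr p) \<partial>lborel) \<le> ennreal \<delta>" .
  qed
qed

text \<open>
  Young's inequality splits the integrand into a small multiple of \<open>B^p\<close> and a large multiple of
  \<open>|G (x + z) - G x|^p\<close>; the latter is small for small \<open>z\<close>.
\<close>

lemma Lp_weighted_translate_continuous:
  fixes G :: "'a::euclidean_space \<Rightarrow> 'b::euclidean_space" and B :: "'a \<Rightarrow> real"
  assumes p: "p > 1" and [measurable]: "G \<in> borel_measurable borel" "B \<in> borel_measurable borel"
    and fin: "\<And>r. (\<integral>\<^sup>+x\<in>cball 0 r. ennreal (norm (G x) powr p) \<partial>lborel) < \<infinity>"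
    and B: "\<And>x. B x \<ge> 0" and finB: "(\<integral>\<^sup>+x\<in>cball 0 r. ennreal (B x powr p) \<partial>lborel) < \<infinity>"
    and "\<delta> > 0"
  obtains \<epsilon> where "\<epsilon> > 0"
    "\<And>z. norm z \<le> \<epsilon> \<Longrightarrow> (\<integral>\<^sup>+x\<in>cball 0 r. ennreal (B x powr (p - 1) * norm (G (x + z) - G x)) \<partial>lborel) \<le> ennreal \<delta>"
proof -
  obtain M where M: "M \<ge> 0" "(\<integral>\<^sup>+x\<in>cball 0 r. ennreal (B x powr p) \<partial>lborel) = ennreal M"
    using finB by (cases "\<integral>\<^sup>+x\<in>cball 0 r. ennreal (B x powr p) \<partial>lborel") auto
  define \<eta> where "\<eta> = \<delta> / (2 * (M + 1))"
  have \<eta>: "\<eta> > 0" "\<eta> * M \<le> \<delta> / 2" using \<open>\<delta> > 0\<close> M by (auto simp: \<eta>_def field_simps)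
  define C where "C = \<eta> powr (1 - p)"
  have C: "C > 0" using \<eta> by (simp add: C_def)
  obtain \<epsilon> where \<epsilon>: "\<epsilon> > 0"
    "\<And>z. norm z \<le> \<epsilon> \<Longrightarrow> (\<integral>\<^sup>+x\<in>cball 0 r. ennreal (norm (G (x + z) - G x) powr p) \<partial>lborel) \<le> ennreal (\<delta> / (2 * C))"
    using Lp_translate_continuous[OF p _ fin, of "\<delta> / (2 * C)" r] C \<open>\<delta> > 0\<close> by auto
  show thesis
  proof (rule that[OF \<epsilon>(1)])
    fix z :: 'a assume z: "norm z \<le> \<epsilon>"
    have "ennreal (B x powr (p - 1) * norm (G (x + z) - G x)) * indicator (cball 0 r) x
      \<le> ennreal \<eta> * (ennreal (B x powr p) * indicator (cball 0 r) x)
        + ennreal C * (ennreal (norm (G (x + z) - G x) powr p) * indicator (cball 0 r) x)" for x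
    proof -
      have "B x powr (p - 1) * norm (G (x + z) - G x) \<le> \<eta> * B x powr p + C * norm (G (x + z) - G x) powr p"
        unfolding C_def by (intro young_cases B \<eta> p) auto
      then have "ennreal (B x powr (p - 1) * norm (G (x + z) - G x))
         \<le> ennreal \<eta> * ennreal (B x powr p) + ennreal C * ennreal (norm (G (x + z) - G x) powr p)"
        using \<eta> C by (simp add: ennreal_mult'[symmetric] ennreal_plus[symmetric] del: ennreal_plus)
      then show ?thesis by (auto simp: indicator_def)
    qed
    then have "(\<integral>\<^sup>+x\<in>cball 0 r. ennreal (B x powr (p - 1) * norm (G (x + z) - G x)) \<partial>lborel)
      \<le> (\<integral>\<^sup>+x. ennreal \<eta> * (ennreal (B x powr p) * indicator (cball 0 r) x)
        + ennreal C * (ennreal (norm (G (x + z) - G x) powr p) * indicator (cball 0 r) x) \<partial>lborel)"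
      by (intro nn_integral_mono) auto
    also have "\<dots> = ennreal \<eta> * ennreal M
        + ennreal C * (\<integral>\<^sup>+x\<in>cball 0 r. ennreal (norm (G (x + z) - G x) powr p) \<partial>lborel)"
      by (subst nn_integral_add) (auto simp: nn_integral_cmult M)
    also have "\<dots> \<le> ennreal \<eta> * ennreal M + ennreal C * ennreal (\<delta> / (2 * C))"
      by (intro add_mono mult_left_mono \<epsilon>(2) z) auto
    also have "\<dots> = ennreal (\<eta> * M + \<delta> / 2)"
      using \<eta> C \<open>\<delta> > 0\<close> M by (simp add: ennreal_mult'[symmetric] ennreal_plus[symmetric] del: ennreal_plus)
    also have "\<dots> \<le> ennreal \<delta>" using \<eta> by (intro ennreal_leI) simp
    finally show "(\<integral>\<^sup>+x\<in>cball 0 r. ennreal (B x powr (p - 1) * norm (G (x + z) - G x)) \<partial>lborel) \<le> ennreal \<delta>" .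
  qed
qed

lemma ennreal_tendsto_0I:
  fixes f :: "nat \<Rightarrow> ennreal"
  assumes "\<And>\<delta>::real. \<delta> > 0 \<Longrightarrow> eventually (\<lambda>n. f n \<le> ennreal \<delta>) sequentially"
  shows "f \<longlonglongrightarrow> 0"
proof (rule order_tendstoI)
  fix a :: ennreal assume "a > 0"
  then obtain d where "0 < d" "d < a" using dense by blast
  then have "d \<noteq> \<infinity>" by auto
  then have "enn2real d > 0" "d = ennreal (enn2real d)"
    using \<open>0 < d\<close> by (auto simp: enn2real_positive_iff less_top)
  with assms[of "enn2real d"] \<open>d < a\<close> show "eventually (\<lambda>n. f n < a) sequentially"
    by (auto elim: eventually_mono)
qed simp

text \<open>
  By Tonelli's theorem the integral is at most an average, over \<open>z\<close> in the support of the kernel, of the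
  quantities treated in \<open>Lp_weighted_translate_continuous\<close>. The weight \<open>B^(p-1)\<close> has the size of the
  \<open>p\<close>-Laplace flux of a field of size \<open>B\<close>.
\<close>

lemma mollify_weighted_L1:
  fixes G :: "'a::euclidean_space \<Rightarrow> 'b::euclidean_space" and B :: "'a \<Rightarrow> real"
  assumes p: "p > 1" and G[measurable]: "G \<in> borel_measurable borel" and [measurable]: "B \<in> borel_measurable borel"
    and loc: "\<And>r. set_integrable lborel (cball 0 r) G"
    and fin: "\<And>r. (\<integral>\<^sup>+x\<in>cball 0 r. ennreal (norm (G x) powr p) \<partial>lborel) < \<infinity>"
    and B: "\<And>x. B x \<ge> 0" and finB: "(\<integral>\<^sup>+x\<in>cball 0 r. ennreal (B x powr p) \<partial>lborel) < \<infinity>"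
    and \<kappa>: "\<And>n. mollifier (inverse (real (Suc n))) (\<kappa> n)"
    and [measurable]: "\<And>n. mollify (\<kappa> n) G \<in> borel_measurable borel"
  shows "(\<lambda>n. \<integral>\<^sup>+x\<in>cball 0 r. ennreal (B x powr (p - 1) * norm (mollify (\<kappa> n) G x - G x)) \<partial>lborel) \<longlonglongrightarrow> 0"
proof (rule ennreal_tendsto_0I)
  fix \<delta> :: real assume "\<delta> > 0"
  obtain \<epsilon> where \<epsilon>: "\<epsilon> > 0"
    "\<And>z. norm z \<le> \<epsilon> \<Longrightarrow> (\<integral>\<^sup>+x\<in>cball 0 r. ennreal (B x powr (p - 1) * norm (G (x + z) - G x)) \<partial>lborel) \<le> ennreal \<delta>"
    by (rule Lp_weighted_translate_continuous[OF p _ _ fin B finB \<open>\<delta> > 0\<close>]) auto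
  have "eventually (\<lambda>n. inverse (real (Suc n)) < \<epsilon>) sequentially"
    using LIMSEQ_inverse_real_of_nat \<epsilon>(1) by (rule order_tendstoD)
  then show "eventually (\<lambda>n. (\<integral>\<^sup>+x\<in>cball 0 r. ennreal (B x powr (p - 1) * norm (mollify (\<kappa> n) G x - G x)) \<partial>lborel) \<le> ennreal \<delta>) sequentially"
  proof (rule eventually_mono)
    fix n assume n: "inverse (real (Suc n)) < \<epsilon>"
    note [measurable] = mollifier_measurable[OF \<kappa>[of n]]
    have pos: "\<kappa> n z \<ge> 0" for z using \<kappa>[of n] by (simp add: mollifier_def)
    have "(\<integral>\<^sup>+x\<in>cball 0 r. ennreal (B x powr (p - 1) * norm (mollify (\<kappa> n) G x - G x)) \<partial>lborel)
      \<le> (\<integral>\<^sup>+x. (\<integral>\<^sup>+z. ennreal (\<kappa> n z) * (ennreal (B x powr (p - 1) * norm (G (x + z) - G x)) * indicator (cball 0 r) x) \<partial>lborel) \<partial>lborel)"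
    proof (intro nn_integral_mono)
      fix x
      have "ennreal (B x powr (p - 1) * norm (mollify (\<kappa> n) G x - G x))
        \<le> ennreal (B x powr (p - 1)) * (\<integral>\<^sup>+z. ennreal (\<kappa> n z * norm (G (x + z) - G x)) \<partial>lborel)"
        by (subst ennreal_mult'') (auto intro!: mult_left_mono mollify_diff_bound[OF \<kappa> G loc])
      also have "\<dots> = (\<integral>\<^sup>+z. ennreal (\<kappa> n z) * ennreal (B x powr (p - 1) * norm (G (x + z) - G x)) \<partial>lborel)"
        by (subst nn_integral_cmult[symmetric])
          (auto intro!: nn_integral_cong simp: ennreal_mult'[symmetric] pos mult_ac)
      finally show "ennreal (B x powr (p - 1) * norm (mollify (\<kappa> n) G x - G x)) * indicator (cball 0 r) x
        \<le> (\<integral>\<^sup>+z. ennreal (\<kappa> n z) * (ennreal (B x powr (p - 1) * norm (G (x + z) - G x)) * indicator (cball 0 r) x) \<partial>lborel)"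
        by (auto simp: indicator_def)
    qed
    also have "\<dots> = (\<integral>\<^sup>+z. (\<integral>\<^sup>+x. ennreal (\<kappa> n z) * (ennreal (B x powr (p - 1) * norm (G (x + z) - G x)) * indicator (cball 0 r) x) \<partial>lborel) \<partial>lborel)"
      by (intro lborel_pair.Fubini') measurable
    also have "\<dots> = (\<integral>\<^sup>+z. ennreal (\<kappa> n z) * (\<integral>\<^sup>+x\<in>cball 0 r. ennreal (B x powr (p - 1) * norm (G (x + z) - G x)) \<partial>lborel) \<partial>lborel)"
      by (intro nn_integral_cong nn_integral_cmult) auto
    also have "\<dots> \<le> (\<integral>\<^sup>+z. ennreal (\<kappa> n z) * ennreal \<delta> \<partial>lborel)"
    proof (intro nn_integral_mono)
      fix z
      show "ennreal (\<kappa> n z) * (\<integral>\<^sup>+x\<in>cball 0 r. ennreal (B x powr (p - 1) * norm (G (x + z) - G x)) \<partial>lborel) \<le> ennreal (\<kappa> n z) * ennreal \<delta>"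
      proof (cases "norm z \<le> inverse (real (Suc n))")
        case True
        then show ?thesis using n by (intro mult_left_mono \<epsilon>(2)) auto
      next
        case False
        then have "\<kappa> n z = 0" using \<kappa>[of n] by (simp add: mollifier_def)
        then show ?thesis by simp
      qed
    qed
    also have "\<dots> = ennreal \<delta>"
      by (subst nn_integral_multc) (auto simp: mollifier_nn_integral[OF \<kappa>])
    finally show "(\<integral>\<^sup>+x\<in>cball 0 r. ennreal (B x powr (p - 1) * norm (mollify (\<kappa> n) G x - G x)) \<partial>lborel) \<le> ennreal \<delta>" .
  qed
qed

section \<open>Weak gradients and limits of fluxes\<close>

lemma powr_le_1_plus_powr:
  fixes x s p :: real
  assumes "x \<ge> 0" "0 < s" "s \<le> p" shows "x powr s \<le> 1 + x powr p"
proof (cases "x \<le> 1")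
  case True
  then have "x powr s \<le> 1" using assms by (intro powr_le1) auto
  then show ?thesis by (simp add: add_increasing2)
next
  case False
  then have "x powr s \<le> x powr p" using assms by (intro powr_mono) auto
  then show ?thesis by simp
qed

lemma set_integrable_bound_powr:
  fixes F :: "'a::euclidean_space \<Rightarrow> 'b::euclidean_space" and B :: "'a \<Rightarrow> real"
  assumes F[measurable]: "F \<in> borel_measurable borel" and B[measurable]: "B \<in> borel_measurable borel"
    and finB: "(\<integral>\<^sup>+x\<in>cball 0 r. ennreal (B x powr p) \<partial>lborel) < \<infinity>"
    and le: "\<And>x. norm (F x) \<le> 1 + B x powr p"
  shows "set_integrable lborel (cball 0 r) F"
  unfolding set_integrable_def integrable_iff_bounded
proof
  have "(\<integral>\<^sup>+x. ennreal (norm (indicator (cball 0 r) x *\<^sub>R F x)) \<partial>lborel)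
     \<le> (\<integral>\<^sup>+x. indicator (cball 0 r) x + ennreal (B x powr p) * indicator (cball 0 r) x \<partial>lborel)"
  proof (intro nn_integral_mono)
    fix x
    show "ennreal (norm (indicator (cball 0 r) x *\<^sub>R F x))
        \<le> indicator (cball 0 r) x + ennreal (B x powr p) * indicator (cball 0 r) x"
      using ennreal_leI[OF le[of x]] by (auto simp: indicator_def ennreal_plus)
  qed
  also have "\<dots> = emeasure lborel (cball (0::'a) r) + (\<integral>\<^sup>+x\<in>cball 0 r. ennreal (B x powr p) \<partial>lborel)"
    by (subst nn_integral_add) auto
  also have "\<dots> < \<infinity>"
    using finB emeasure_bounded_finite[of "cball (0::'a) r"] by auto
  finally show "(\<integral>\<^sup>+x. ennreal (norm (indicator (cball 0 r) x *\<^sub>R F x)) \<partial>lborel) < \<infinity>" .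
qed measurable

lemma integral_mult_uniform_limit:
  fixes F :: "'a::euclidean_space \<Rightarrow> real" and \<zeta> :: "nat \<Rightarrow> 'a \<Rightarrow> real"
  assumes cont: "\<And>n. continuous_on UNIV (\<zeta> n)" "continuous_on UNIV \<zeta>'"
    and zero: "\<And>n x. norm x > r \<Longrightarrow> \<zeta> n x * F x = 0" "\<And>x. norm x > r \<Longrightarrow> \<zeta>' x * F x = 0"
    and lim: "uniform_limit (cball 0 r) \<zeta> \<zeta>' sequentially"
    and F: "set_integrable lborel (cball 0 r) F"
  shows "(\<lambda>n. LINT x|lborel. \<zeta> n x * F x) \<longlonglongrightarrow> (LINT x|lborel. \<zeta>' x * F x)"
proof (rule tendstoI)
  fix e :: real assume "e > 0"
  define I where "I = (LINT x|lborel. indicator (cball 0 r) x * \<bar>F x\<bar>)"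
  have intF: "integrable lborel (\<lambda>x. indicator (cball 0 r) x * \<bar>F x\<bar>)"
    using set_integrable_abs[OF F] by (simp add: set_integrable_def)
  have "I \<ge> 0" unfolding I_def by (intro integral_nonneg_AE) auto
  define e' where "e' = e / (I + 1)"
  have "e' > 0" using \<open>e > 0\<close> \<open>I \<ge> 0\<close> by (simp add: e'_def)
  have "e' * I < e" using \<open>e > 0\<close> \<open>I \<ge> 0\<close> by (simp add: e'_def field_simps)
  from uniform_limitD[OF lim \<open>e' > 0\<close>]
  show "eventually (\<lambda>n. dist (LINT x|lborel. \<zeta> n x * F x) (LINT x|lborel. \<zeta>' x * F x) < e) sequentially"
  proof (rule eventually_mono)
    fix n assume n: "\<forall>x\<in>cball 0 r. dist (\<zeta> n x) (\<zeta>' x) < e'"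
    have int: "integrable lborel (\<lambda>x. \<zeta> n x * F x)" "integrable lborel (\<lambda>x. \<zeta>' x * F x)"
      using integrable_mult_compact_support[OF cont(1)[of n] _ F]
        integrable_mult_compact_support[OF cont(2) _ F] zero by auto
    have "dist (LINT x|lborel. \<zeta> n x * F x) (LINT x|lborel. \<zeta>' x * F x)
      = norm (LINT x|lborel. \<zeta> n x * F x - \<zeta>' x * F x)"
      using int by (simp add: dist_norm)
    also have "\<dots> \<le> (LINT x|lborel. norm (\<zeta> n x * F x - \<zeta>' x * F x))"
      by (rule integral_norm_bound)
    also have "\<dots> \<le> (LINT x|lborel. e' * (indicator (cball 0 r) x * \<bar>F x\<bar>))"
    proof (rule integral_mono)
      fix x
      show "norm (\<zeta> n x * F x - \<zeta>' x * F x) \<le> e' * (indicator (cball 0 r) x * \<bar>F x\<bar>)"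
      proof (cases "norm x \<le> r")
        case True
        then have "\<bar>\<zeta> n x - \<zeta>' x\<bar> \<le> e'" using n by (auto simp: dist_real_def less_imp_le)
        then have "\<bar>\<zeta> n x - \<zeta>' x\<bar> * \<bar>F x\<bar> \<le> e' * \<bar>F x\<bar>" by (intro mult_right_mono) auto
        then show ?thesis using True by (simp add: left_diff_distrib[symmetric] abs_mult)
      qed (simp add: zero)
    qed (use int intF in auto)
    also have "\<dots> = e' * I" by (simp add: I_def)
    finally show "dist (LINT x|lborel. \<zeta> n x * F x) (LINT x|lborel. \<zeta>' x * F x) < e"
      using \<open>e' * I < e\<close> by simp
  qed
qed

text \<open>
  The gradient is assumed Borel measurable, and integrals are taken over \<open>lborel\<close>: compositions such as
  \<open>G (x + z)\<close> are then measurable on the product space, as Tonelli's theorem requires.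
\<close>

locale continuous_sobolev =
  fixes p :: real and u :: "'a::euclidean_space \<Rightarrow> real" and G :: "'a \<Rightarrow> 'a"
  assumes p: "p > 1" and u_cont: "continuous_on UNIV u"
    and G_borel [measurable]: "G \<in> borel_measurable borel"
    and G_fin: "\<And>r. (\<integral>\<^sup>+x\<in>cball 0 r. ennreal (norm (G x) powr p) \<partial>lborel) < \<infinity>"
    and weak: "\<And>\<phi> b. \<phi> \<in> test_functions \<Longrightarrow> b \<in> Basis \<Longrightarrow>
      (LINT x|lborel. u x * (grad \<phi> x \<bullet> b)) = - (LINT x|lborel. (G x \<bullet> b) * \<phi> x)"
begin

lemma G_loc: "set_integrable lborel (cball 0 r) G"
proof (rule set_integrable_bound_powr[OF _ _ G_fin])
  show "norm (G x) \<le> 1 + norm (G x) powr p" for x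
    using powr_le_1_plus_powr[of "norm (G x)" 1 p] p by simp
qed auto

text \<open>
  The derivative falls on the kernel, a test function of the integration variable, and the definition of
  the weak gradient moves it to \<open>u\<close>.
\<close>

lemma grad_mollify:
  assumes \<kappa>: "\<kappa> \<in> test_functions"
  shows "grad (mollify \<kappa> u) x = mollify \<kappa> G x"
proof (rule euclidean_eqI)
  fix b :: 'a assume b: "b \<in> Basis"
  have \<kappa>x: "(\<lambda>y. \<kappa> (y - x)) \<in> test_functions" by (rule test_function_translate[OF \<kappa>])
  obtain r where "\<And>y. norm y > r \<Longrightarrow> \<kappa> (y - x) = 0"
    using test_functionsD(2)[OF \<kappa>x] by blast
  then have int: "integrable lborel (\<lambda>y. \<kappa> (y - x) *\<^sub>R G y)"
    by (intro integrable_mult_compact_support G_loc smooth_continuous test_functionsD(1)[OF \<kappa>x]) auto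
  have "grad (mollify \<kappa> u) x \<bullet> b = - mollify (\<lambda>z. grad \<kappa> z \<bullet> b) u x"
    using grad_inner[OF b] frechet_derivative_at[OF mollify_has_derivative[OF \<kappa> u_cont], symmetric] by simp
  also have "\<dots> = - (LINT y|lborel. u y * (grad (\<lambda>y. \<kappa> (y - x)) y \<bullet> b))"
    by (simp add: mollify_def grad_translate[OF test_functionsD(1)[OF \<kappa>]] mult.commute)
  also have "\<dots> = (LINT y|lborel. (G y \<bullet> b) * \<kappa> (y - x))"
    using weak[OF \<kappa>x b] by simp
  also have "\<dots> = (LINT y|lborel. (\<kappa> (y - x) *\<^sub>R G y) \<bullet> b)"
    by (simp add: mult.commute)
  also have "\<dots> = mollify \<kappa> G x \<bullet> b"
    unfolding mollify_def using int by (rule integral_inner_left)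
  finally show "grad (mollify \<kappa> u) x \<bullet> b = mollify \<kappa> G x \<bullet> b" .
qed

lemma mollify_G_continuous: "\<kappa> \<in> test_functions \<Longrightarrow> continuous_on S (mollify \<kappa> G)"
  using smooth_grad_continuous[OF smooth_mollify[OF _ u_cont], of \<kappa> S] grad_mollify[of \<kappa>]
  by (metis (no_types, lifting) continuous_on_cong)

text \<open>
  The error of replacing the mollified gradient by \<open>G\<close> is at most \<open>sup |\<zeta> n|\<close> times the integral in
  \<open>mollify_weighted_L1\<close>; what remains is the uniform convergence of \<open>\<zeta>\<close> against a fixed integrable
  function.
\<close>

lemma flux_limit:
  fixes A :: "'a \<Rightarrow> 'a" and \<zeta> :: "nat \<Rightarrow> 'a \<Rightarrow> real"
  assumes A[measurable]: "A \<in> borel_measurable borel" and B[measurable]: "B \<in> borel_measurable borel"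
    and B: "\<And>x. B x \<ge> 0" and finB: "(\<integral>\<^sup>+x\<in>cball 0 r. ennreal (B x powr p) \<partial>lborel) < \<infinity>"
    and AB: "\<And>x. norm (A x) \<le> B x powr (p - 1)"
    and cont: "\<And>n. continuous_on UNIV (\<zeta> n)" "continuous_on UNIV \<zeta>'"
    and zero: "\<And>n x. norm x > r \<Longrightarrow> \<zeta> n x = 0" "\<And>x. norm x > r \<Longrightarrow> \<zeta>' x = 0"
    and lim: "uniform_limit (cball 0 r) \<zeta> \<zeta>' sequentially"
    and \<kappa>: "\<And>n. mollifier (inverse (real (Suc n))) (\<kappa> n)"
  shows "\<And>n. integrable lborel (\<lambda>x. \<zeta> n x * (A x \<bullet> mollify (\<kappa> n) G x))"
    and "integrable lborel (\<lambda>x. \<zeta>' x * (A x \<bullet> G x))"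
    and "(\<lambda>n. LINT x|lborel. \<zeta> n x * (A x \<bullet> mollify (\<kappa> n) G x)) \<longlonglongrightarrow> (LINT x|lborel. \<zeta>' x * (A x \<bullet> G x))"
proof -
  have \<kappa>t: "\<kappa> n \<in> test_functions" for n using \<kappa> by (simp add: mollifier_def)
  have [measurable]: "mollify (\<kappa> n) G \<in> borel_measurable borel" for n
    by (intro borel_measurable_continuous_onI mollify_G_continuous \<kappa>t)
  have A_loc: "set_integrable lborel (cball 0 r) A"
    by (rule set_integrable_bound_powr[OF _ _ finB])
      (use p AB B powr_le_1_plus_powr[of "B _" "p - 1" p] in \<open>auto intro: order_trans\<close>)
  have "set_integrable lborel (cball 0 r) (\<lambda>x. norm (G x) powr p)" 
    by (rule set_integrable_bound_powr[OF _ _ G_fin]) auto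
  moreover have "set_integrable lborel (cball 0 r) (\<lambda>x. B x powr p)" 
    by (rule set_integrable_bound_powr[OF _ _ finB]) auto
  ultimately have GB: "set_integrable lborel (cball 0 r) (\<lambda>x. B x powr p + norm (G x) powr p)"
    by (intro set_integral_add)
  have AG: "set_integrable lborel (cball 0 r) (\<lambda>x. A x \<bullet> G x)"
  proof (rule set_integrable_bound[OF GB])
    have "norm (A x \<bullet> G x) \<le> norm (B x powr p + norm (G x) powr p)" for x
    proof -
      have "norm (A x \<bullet> G x) \<le> norm (A x) * norm (G x)" by (simp add: Cauchy_Schwarz_ineq2)
      also have "\<dots> \<le> B x powr (p - 1) * norm (G x)" by (intro mult_right_mono AB) auto
      also have "\<dots> \<le> B x powr p + norm (G x) powr p"
        using young_cases[of "B x" "norm (G x)" 1 p] B p by simp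
      finally show ?thesis by simp
    qed
    then show "AE x in lborel. x \<in> cball 0 r \<longrightarrow> norm (A x \<bullet> G x) \<le> norm (B x powr p + norm (G x) powr p)"
      by simp
  qed (auto simp: set_borel_measurable_def)
  have AGn: "integrable lborel (\<lambda>x. \<zeta> n x * (A x \<bullet> mollify (\<kappa> n) G x))" for n
  proof -
    have "continuous_on UNIV (\<lambda>x. \<zeta> n x *\<^sub>R mollify (\<kappa> n) G x)"
      by (intro continuous_intros cont mollify_G_continuous \<kappa>t)
    then have "integrable lborel (\<lambda>x. A x \<bullet> (\<zeta> n x *\<^sub>R mollify (\<kappa> n) G x))"
      by (rule integrable_inner_compact_support[OF _ _ A_loc]) (simp add: zero)
    then show ?thesis by simp
  qed
  then show "\<And>n. integrable lborel (\<lambda>x. \<zeta> n x * (A x \<bullet> mollify (\<kappa> n) G x))" .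
  show "integrable lborel (\<lambda>x. \<zeta>' x * (A x \<bullet> G x))"
    using integrable_mult_compact_support[OF cont(2) _ AG] zero(2) by simp
  have AGn': "integrable lborel (\<lambda>x. \<zeta> n x * (A x \<bullet> G x))" for n
    using integrable_mult_compact_support[OF cont(1)[of n] _ AG] zero(1) by simp
  have lim1: "(\<lambda>n. LINT x|lborel. \<zeta> n x * (A x \<bullet> G x)) \<longlonglongrightarrow> (LINT x|lborel. \<zeta>' x * (A x \<bullet> G x))"
    by (rule integral_mult_uniform_limit[OF cont _ _ lim AG]) (simp_all add: zero)
  have "bounded (\<zeta>' ` cball 0 r)"
    using cont(2) continuous_on_subset by (intro compact_imp_bounded compact_continuous_image) auto
  then obtain M where M: "\<And>x. norm x \<le> r \<Longrightarrow> norm (\<zeta>' x) \<le> M"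
    unfolding bounded_iff by (metis imageI mem_cball_0)
  define I where "I n = (\<integral>\<^sup>+x\<in>cball 0 r. ennreal (B x powr (p - 1) * norm (mollify (\<kappa> n) G x - G x)) \<partial>lborel)" for n
  have I: "I \<longlonglongrightarrow> 0"
    unfolding I_def by (rule mollify_weighted_L1[OF p _ _ G_loc G_fin B finB \<kappa>]) auto
  define d where "d n = (LINT x|lborel. \<zeta> n x * (A x \<bullet> mollify (\<kappa> n) G x)) - (LINT x|lborel. \<zeta> n x * (A x \<bullet> G x))" for n
  have ev: "eventually (\<lambda>n. ennreal (norm (d n)) \<le> ennreal (\<bar>M\<bar> + 1) * I n) sequentially"
    using uniform_limitD[OF lim, of 1, simplified]
  proof (rule eventually_mono)
    fix n assume n: "\<forall>x\<in>cball 0 r. dist (\<zeta> n x) (\<zeta>' x) < 1"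
    have \<zeta>n: "\<bar>\<zeta> n x\<bar> \<le> (\<bar>M\<bar> + 1) * indicator (cball 0 r) x" for x
    proof (cases "norm x \<le> r")
      case True
      then have "dist (\<zeta> n x) (\<zeta>' x) < 1" using n by simp
      then show ?thesis using M[OF True] True by (simp add: dist_real_def)
    qed (simp add: zero)
    have "d n = (LINT x|lborel. \<zeta> n x * (A x \<bullet> (mollify (\<kappa> n) G x - G x)))"
      unfolding d_def
      by (subst Bochner_Integration.integral_diff[OF AGn AGn', symmetric]) (simp add: inner_diff_right right_diff_distrib)
    moreover have "integrable lborel (\<lambda>x. \<zeta> n x * (A x \<bullet> (mollify (\<kappa> n) G x - G x)))"
      using Bochner_Integration.integrable_diff[OF AGn[of n] AGn'[of n]] by (simp add: inner_diff_right right_diff_distrib)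
    ultimately have "ennreal (norm (d n)) \<le> (\<integral>\<^sup>+x. ennreal (norm (\<zeta> n x * (A x \<bullet> (mollify (\<kappa> n) G x - G x)))) \<partial>lborel)"
      using integral_norm_bound_ennreal by metis
    also have "\<dots> \<le> (\<integral>\<^sup>+x. ennreal (\<bar>M\<bar> + 1) * (ennreal (B x powr (p - 1) * norm (mollify (\<kappa> n) G x - G x)) * indicator (cball 0 r) x) \<partial>lborel)"
    proof (intro nn_integral_mono)
      fix x
      have "\<bar>A x \<bullet> (mollify (\<kappa> n) G x - G x)\<bar> \<le> norm (A x) * norm (mollify (\<kappa> n) G x - G x)"
        by (rule Cauchy_Schwarz_ineq2)
      also have "\<dots> \<le> B x powr (p - 1) * norm (mollify (\<kappa> n) G x - G x)"
        by (intro mult_right_mono AB) auto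
      finally have le: "norm (\<zeta> n x * (A x \<bullet> (mollify (\<kappa> n) G x - G x)))
          \<le> ((\<bar>M\<bar> + 1) * indicator (cball 0 r) x) * (B x powr (p - 1) * norm (mollify (\<kappa> n) G x - G x))"
        using \<zeta>n[of x] by (auto simp: abs_mult intro!: mult_mono)
      show "ennreal (norm (\<zeta> n x * (A x \<bullet> (mollify (\<kappa> n) G x - G x)))) \<le>
          ennreal (\<bar>M\<bar> + 1) * (ennreal (B x powr (p - 1) * norm (mollify (\<kappa> n) G x - G x)) * indicator (cball 0 r) x)"
        using ennreal_leI[OF le] by (cases "norm x \<le> r") (auto simp: ennreal_mult')
    qed
    also have "\<dots> = ennreal (\<bar>M\<bar> + 1) * I n"
      unfolding I_def by (subst nn_integral_cmult) auto
    finally show "ennreal (norm (d n)) \<le> ennreal (\<bar>M\<bar> + 1) * I n" .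
  qed
  have "(\<lambda>n. ennreal (\<bar>M\<bar> + 1) * I n) \<longlonglongrightarrow> ennreal (\<bar>M\<bar> + 1) * 0"
    by (intro ennreal_tendsto_cmult I) auto
  then have lim0: "(\<lambda>n. ennreal (\<bar>M\<bar> + 1) * I n) \<longlonglongrightarrow> 0" by simp
  have "(\<lambda>n. ennreal (norm (d n))) \<longlonglongrightarrow> 0"
    by (rule tendsto_sandwich[OF _ ev tendsto_const lim0]) auto
  then have "(\<lambda>n. norm (d n)) \<longlonglongrightarrow> 0"
    using tendsto_ennreal_iff[of "\<lambda>n. norm (d n)" sequentially 0] by simp
  then have "d \<longlonglongrightarrow> 0" by (rule tendsto_norm_zero_cancel)
  from tendsto_add[OF this lim1]
  show "(\<lambda>n. LINT x|lborel. \<zeta> n x * (A x \<bullet> mollify (\<kappa> n) G x)) \<longlonglongrightarrow> (LINT x|lborel. \<zeta>' x * (A x \<bullet> G x))"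
    by (simp add: d_def)
qed

end

section \<open>The energy inequality\<close>

lemma grad_mult:
  assumes "smooth f" "smooth g"
  shows "grad (\<lambda>x. f x * g x) x = g x *\<^sub>R grad f x + f x *\<^sub>R grad g x"
  using has_derivative_mult[OF smooth_has_derivative_grad[OF assms(1), of x] smooth_has_derivative_grad[OF assms(2), of x]]
  by (intro grad_eqI) (simp add: inner_add_left algebra_simps)

lemma grad_power_Suc:
  assumes "smooth f"
  shows "grad (\<lambda>x. f x ^ Suc k) x = (real (Suc k) * f x ^ k) *\<^sub>R grad f x"
  using has_derivative_power[OF smooth_has_derivative_grad[OF assms, of x], of "Suc k"]
  by (intro grad_eqI) (simp add: algebra_simps)

lemma uniform_limit_mult_continuous:
  fixes f g :: "nat \<Rightarrow> 'a::euclidean_space \<Rightarrow> real"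
  assumes "uniform_limit (cball 0 r) f f' sequentially" "uniform_limit (cball 0 r) g g' sequentially"
    and "continuous_on UNIV f'" "continuous_on UNIV g'"
  shows "uniform_limit (cball 0 r) (\<lambda>n x. f n x * g n x) (\<lambda>x. f' x * g' x) sequentially"
  using assms continuous_on_subset
  by (intro uniform_lim_mult compact_imp_bounded compact_continuous_image) auto

lemma uniform_limit_power_continuous:
  fixes f :: "nat \<Rightarrow> 'a::euclidean_space \<Rightarrow> real"
  assumes "uniform_limit (cball 0 r) f f' sequentially" "continuous_on UNIV f'"
  shows "uniform_limit (cball 0 r) (\<lambda>n x. f n x ^ m) (\<lambda>x. f' x ^ m) sequentially"
proof (induction m)
  case 0
  then show ?case by (simp add: uniform_limit_const)
next
  case (Suc m)
  then show ?case
    using assms by (auto intro!: uniform_limit_mult_continuous continuous_intros)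
qed

lemma mollifier_sequence_exists:
  "\<exists>\<kappa> :: nat \<Rightarrow> 'a::euclidean_space \<Rightarrow> real. \<forall>n. mollifier (inverse (real (Suc n))) (\<kappa> n)"
proof -
  have "\<exists>\<kappa> :: 'a \<Rightarrow> real. mollifier (inverse (real (Suc n))) \<kappa>" for n
    using mollifier_exists[of "inverse (real (Suc n))", where 'a = 'a] by auto
  then show ?thesis by metis
qed

lemma continuous_eq_0_if_AE:
  fixes f :: "'a::euclidean_space \<Rightarrow> real"
  assumes f: "continuous_on UNIV f" and AE: "AE x in lborel. f x = 0"
  shows "f x = 0"
proof (rule ccontr)
  assume "f x \<noteq> 0"
  have op: "open {x. f x \<noteq> 0}"
    using f by (intro open_Collect_neq) auto
  have "{x. f x \<noteq> 0} \<in> null_sets lborel"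
    using AE op by (simp add: AE_iff_null_sets)
  then have "negligible {x. f x \<noteq> 0}"
    using null_sets_completionI negligible_iff_null_sets by blast
  then show False
    using open_not_negligible[OF op] \<open>f x \<noteq> 0\<close> by auto
qed

text \<open>
  The function \<open>H\<close> stands for the absorption term: the weak inequality reads \<open>div (|G|^(p-2) * G) \<ge> H\<close>.
\<close>

locale p_subsolution = continuous_sobolev p u G for p :: real and u :: "'a::euclidean_space \<Rightarrow> real" and G +
  fixes H :: "'a \<Rightarrow> real"
  assumes u_nonneg: "u x \<ge> 0" and H_cont: "continuous_on UNIV H"
    and subsol: "\<phi> \<in> test_functions \<Longrightarrow> (\<And>x. \<phi> x \<ge> 0) \<Longrightarrow>
      (LINT x|lborel. (norm (G x) powr (p - 2) *\<^sub>R G x) \<bullet> grad \<phi> x) \<le> - (LINT x|lborel. H x * \<phi> x)"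
begin

definition flux :: "'a \<Rightarrow> 'a" where "flux x = norm (G x) powr (p - 2) *\<^sub>R G x"

lemma flux_borel [measurable]: "flux \<in> borel_measurable borel"
  unfolding flux_def by measurable

lemma norm_flux: "norm (flux x) = norm (G x) powr (p - 1)"
  by (cases "G x = 0") (simp_all add: flux_def powr_diff field_simps power2_eq_square)

lemma flux_inner: "flux x \<bullet> G x = norm (G x) powr p"
  by (cases "G x = 0") (simp_all add: flux_def powr_diff dot_square_norm)

lemma flux_loc: "set_integrable lborel (cball 0 r) flux"
  by (rule set_integrable_bound_powr[OF _ _ G_fin])
    (use p powr_le_1_plus_powr[of "norm (G _)" "p - 1" p] in \<open>auto simp: norm_flux\<close>)

text \<open>
  Formally this is the inequality tested with \<open>u^(m+1) * \<psi>\<close>. It is tested with \<open>v^(m+1) * \<psi>\<close> for the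
  mollifications \<open>v\<close> of \<open>u\<close>, and each of the three resulting integrals converges.
\<close>

lemma energy_inequality:
  fixes \<psi> :: "'a \<Rightarrow> real"
  assumes \<psi>: "\<psi> \<in> test_functions" "\<And>x. \<psi> x \<ge> 0"
  shows "integrable lborel (\<lambda>x. real (Suc m) * u x ^ m * \<psi> x * norm (G x) powr p)" (is "integrable _ ?E1")
    and "integrable lborel (\<lambda>x. u x ^ Suc m * (flux x \<bullet> grad \<psi> x))" (is "integrable _ ?E2")
    and "integrable lborel (\<lambda>x. H x * (u x ^ Suc m * \<psi> x))" (is "integrable _ ?E3")
    and "(LINT x|lborel. real (Suc m) * u x ^ m * \<psi> x * norm (G x) powr p
      + u x ^ Suc m * (flux x \<bullet> grad \<psi> x) + H x * (u x ^ Suc m * \<psi> x)) \<le> 0"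
proof -
  obtain \<kappa> :: "nat \<Rightarrow> 'a \<Rightarrow> real" where \<kappa>: "\<And>n. mollifier (inverse (real (Suc n))) (\<kappa> n)"
    using mollifier_sequence_exists by blast
  obtain r where r: "\<And>x. norm x > r \<Longrightarrow> \<psi> x = 0"
    using test_functionsD(2)[OF \<psi>(1)] by blast
  have gr: "grad \<psi> x = 0" if "norm x > r" for x
    using grad_eq_0_outside[of r \<psi> x] r that by auto
  have \<psi>s: "smooth \<psi>" by (rule test_functionsD(1)[OF \<psi>(1)])
  have \<kappa>t: "\<kappa> n \<in> test_functions" for n using \<kappa> by (simp add: mollifier_def)
  define v where "v n = mollify (\<kappa> n) u" for n
  have vs: "smooth (v n)" for n
    unfolding v_def by (intro smooth_mollify \<kappa>t u_cont)
  have v0: "v n x \<ge> 0" for n x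
    unfolding v_def by (intro mollify_nonneg[OF \<kappa>] u_nonneg)
  have lim: "uniform_limit (cball 0 r) v u sequentially"
    unfolding v_def by (rule mollify_uniform_limit[OF u_cont \<kappa>])
  note cont = smooth_continuous[OF vs] smooth_continuous[OF \<psi>s] u_cont smooth_grad_continuous[OF \<psi>s] H_cont
  define \<zeta> where "\<zeta> n x = real (Suc m) * v n x ^ m * \<psi> x" for n x
  define \<zeta>' where "\<zeta>' x = real (Suc m) * u x ^ m * \<psi> x" for x
  have lim\<zeta>: "uniform_limit (cball 0 r) \<zeta> \<zeta>' sequentially"
    unfolding \<zeta>_def \<zeta>'_def
    by (intro uniform_limit_mult_continuous uniform_limit_power_continuous lim uniform_limit_const continuous_intros cont)
  have cont\<zeta>: "continuous_on UNIV (\<zeta> n)" "continuous_on UNIV \<zeta>'" for n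
    unfolding \<zeta>_def \<zeta>'_def by (intro continuous_intros cont)+
  have "norm x > r \<Longrightarrow> \<zeta> n x = 0" "norm x > r \<Longrightarrow> \<zeta>' x = 0" for n x
    by (simp_all add: \<zeta>_def \<zeta>'_def r)
  note L1 = flux_limit[where A = flux and B = "\<lambda>x. norm (G x)" and r = r and \<zeta> = \<zeta> and \<zeta>' = \<zeta>' and \<kappa> = \<kappa>, OF _ _ _ G_fin _ cont\<zeta> this lim\<zeta> \<kappa>, simplified norm_flux flux_inner, simplified]
  from L1(2) show E1: "integrable lborel ?E1" by (simp add: \<zeta>'_def)
  have "integrable lborel (\<lambda>x. flux x \<bullet> grad \<psi> x)"
    by (rule integrable_inner_compact_support[OF cont(4) gr flux_loc])
  then have F: "set_integrable lborel (cball 0 r) (\<lambda>x. flux x \<bullet> grad \<psi> x)"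
    unfolding set_integrable_def by (intro integrable_mult_indicator) auto
  have cp: "continuous_on UNIV (\<lambda>x. v n x ^ Suc m)" "continuous_on UNIV (\<lambda>x. u x ^ Suc m)" for n
    by (intro continuous_intros cont)+
  have E2n: "integrable lborel (\<lambda>x. v n x ^ Suc m * (flux x \<bullet> grad \<psi> x))" for n
    using integrable_mult_compact_support[OF cp(1)[of n] _ F] gr by simp
  show E2: "integrable lborel ?E2"
    using integrable_mult_compact_support[OF cp(2) _ F] gr by simp
  have limp: "uniform_limit (cball 0 r) (\<lambda>n x. v n x ^ Suc m) (\<lambda>x. u x ^ Suc m) sequentially"
    by (intro uniform_limit_power_continuous lim cont)
  have L2: "(\<lambda>n. LINT x|lborel. v n x ^ Suc m * (flux x \<bullet> grad \<psi> x)) \<longlonglongrightarrow> (LINT x|lborel. ?E2 x)"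
    by (rule integral_mult_uniform_limit[OF cp _ _ limp F]) (simp_all add: gr)
  have H\<psi>: "set_integrable lborel (cball 0 r) (\<lambda>x. H x * \<psi> x)"
    by (intro continuous_set_integrable continuous_intros cont) auto
  have "integrable lborel (\<lambda>x. u x ^ Suc m * (H x * \<psi> x))"
    using integrable_mult_compact_support[OF cp(2) _ H\<psi>] r by simp
  then show E3: "integrable lborel ?E3" by (simp add: mult_ac)
  have L3: "(\<lambda>n. LINT x|lborel. v n x ^ Suc m * (H x * \<psi> x)) \<longlonglongrightarrow> (LINT x|lborel. u x ^ Suc m * (H x * \<psi> x))"
    by (rule integral_mult_uniform_limit[OF cp _ _ limp H\<psi>]) (simp_all add: r)
  have le: "(LINT x|lborel. \<zeta> n x * (flux x \<bullet> mollify (\<kappa> n) G x)) + (LINT x|lborel. v n x ^ Suc m * (flux x \<bullet> grad \<psi> x))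
      + (LINT x|lborel. v n x ^ Suc m * (H x * \<psi> x)) \<le> 0" for n
  proof -
    let ?\<phi> = "\<lambda>x. v n x ^ Suc m * \<psi> x"
    have t: "?\<phi> \<in> test_functions"
      by (intro test_function_mult smooth_power vs \<psi>)
    have gv: "grad (v n) x = mollify (\<kappa> n) G x" for x
      unfolding v_def by (rule grad_mollify[OF \<kappa>t])
    have "grad ?\<phi> x = \<zeta> n x *\<^sub>R mollify (\<kappa> n) G x + v n x ^ Suc m *\<^sub>R grad \<psi> x" for x
      unfolding grad_mult[OF smooth_power[OF vs] \<psi>s] grad_power_Suc[OF vs] gv \<zeta>_def by simp
    then have "(LINT x|lborel. flux x \<bullet> grad ?\<phi> x)
      = (LINT x|lborel. \<zeta> n x * (flux x \<bullet> mollify (\<kappa> n) G x) + v n x ^ Suc m * (flux x \<bullet> grad \<psi> x))"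
      by (simp add: inner_add_right)
    also have "\<dots> = (LINT x|lborel. \<zeta> n x * (flux x \<bullet> mollify (\<kappa> n) G x)) + (LINT x|lborel. v n x ^ Suc m * (flux x \<bullet> grad \<psi> x))"
      by (intro Bochner_Integration.integral_add L1(1) E2n)
    finally show ?thesis
      using subsol[OF t] v0 \<psi>(2) by (simp add: flux_def mult_ac)
  qed
  have "(LINT x|lborel. ?E1 x) + (LINT x|lborel. ?E2 x) + (LINT x|lborel. u x ^ Suc m * (H x * \<psi> x)) \<le> 0"
    by (rule LIMSEQ_le_const2[OF tendsto_add[OF tendsto_add[OF L1(3)[unfolded \<zeta>'_def] L2] L3]]) (use le in auto)
  then show "(LINT x|lborel. ?E1 x + ?E2 x + ?E3 x) \<le> 0"
    using E1 E2 E3 by (simp add: mult_ac)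
qed

text \<open>
  Let \<open>\<omega>\<close> be a cutoff version of the coordinate \<open>x \<bullet> b\<close>, with derivative \<open>c\<close> in direction \<open>b\<close> on
  the support of \<open>u\<close>. The weak gradient tested with \<open>\<omega> * v\<close>, for the mollifications \<open>v\<close> of \<open>u\<close>, gives
  \<open>c * \<integral> u^2 + \<integral> u * \<omega> * (G \<bullet> b) = - \<integral> u * \<omega> * (G \<bullet> b)\<close> in the limit, and \<open>u * G = 0\<close>.
\<close>

lemma eq_0_if_gradient_vanishes_where_nonzero:
  assumes uG: "AE x in lborel. u x = 0 \<or> G x = 0" and R: "R > 0" "\<And>x. norm x \<ge> R \<Longrightarrow> u x = 0"
  shows "u x = 0"
proof -
  obtain \<phi> :: "real \<Rightarrow> 'a \<Rightarrow> real" and c D :: real where c: "c > 0"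
    and \<phi>: "\<forall>R>0. \<phi> R \<in> test_functions \<and> (\<forall>x. 0 \<le> \<phi> R x \<and> \<phi> R x \<le> 1 \<and> norm (grad (\<phi> R) x) \<le> D / R
      \<and> (norm x \<le> R \<longrightarrow> \<phi> R x = c \<and> grad (\<phi> R) x = 0)
      \<and> (norm x \<ge> 2 * R \<longrightarrow> \<phi> R x = 0 \<and> grad (\<phi> R) x = 0))"
    using cutoff_family by (elim exE conjE)
  have \<phi>t: "\<phi> R \<in> test_functions" and \<phi>c: "norm x \<le> R \<Longrightarrow> \<phi> R x = c"
    and g\<phi>: "norm x \<le> R \<Longrightarrow> grad (\<phi> R) x = 0" for x
    using \<phi>[rule_format, OF R(1)] by auto
  obtain \<kappa> :: "nat \<Rightarrow> 'a \<Rightarrow> real" where \<kappa>: "\<And>n. mollifier (inverse (real (Suc n))) (\<kappa> n)"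
    using mollifier_sequence_exists by blast
  obtain b :: 'a where b: "b \<in> Basis" using nonempty_Basis by blast
  define \<omega> where "\<omega> x = (x \<bullet> b) * \<phi> R x" for x
  have \<phi>s: "smooth (\<phi> R)" using test_functionsD(1)[OF \<phi>t] .
  have \<omega>t: "\<omega> \<in> test_functions"
    unfolding \<omega>_def by (intro test_function_mult smooth_inner \<phi>t R)
  have \<omega>s: "smooth \<omega>" using test_functionsD(1)[OF \<omega>t] .
  obtain r where r: "\<And>x. norm x > r \<Longrightarrow> \<omega> x = 0"
    using test_functionsD(2)[OF \<omega>t] by blast
  have gr: "grad \<omega> x = 0" if "norm x > r" for x
    using grad_eq_0_outside[of r \<omega> x] r that by auto
  have g\<omega>: "grad \<omega> x \<bullet> b = c" if "norm x \<le> R" for x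
  proof -
    have "grad \<omega> x = \<phi> R x *\<^sub>R b + (x \<bullet> b) *\<^sub>R grad (\<phi> R) x"
      unfolding \<omega>_def
      by (rule grad_eqI) (auto intro!: derivative_eq_intros smooth_has_derivative_grad[OF \<phi>s] simp: inner_commute algebra_simps)
    then show ?thesis using that R(1) b by (simp add: \<phi>c g\<phi>)
  qed
  have \<kappa>t: "\<kappa> n \<in> test_functions" for n using \<kappa> by (simp add: mollifier_def)
  define v where "v n = mollify (\<kappa> n) u" for n
  have vs: "smooth (v n)" for n
    unfolding v_def by (intro smooth_mollify \<kappa>t u_cont)
  have lim: "uniform_limit (cball 0 r) v u sequentially"
    unfolding v_def by (rule mollify_uniform_limit[OF u_cont \<kappa>])
  note cont = smooth_continuous[OF vs] smooth_continuous[OF \<omega>s] u_cont smooth_grad_continuous[OF \<omega>s]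
  have conte: "continuous_on UNIV (\<lambda>x. v n x * (grad \<omega> x \<bullet> b))" "continuous_on UNIV (\<lambda>x. u x * (grad \<omega> x \<bullet> b))" for n
    by (intro continuous_intros cont)+
  have u_loc: "set_integrable lborel (cball 0 r) u"
    by (intro continuous_set_integrable cont) auto
  have "uniform_limit (cball 0 r) (\<lambda>n x. v n x * (grad \<omega> x \<bullet> b)) (\<lambda>x. u x * (grad \<omega> x \<bullet> b)) sequentially"
    by (intro uniform_limit_mult_continuous lim uniform_limit_const continuous_intros cont)
  then have L1: "(\<lambda>n. LINT x|lborel. (v n x * (grad \<omega> x \<bullet> b)) * u x) \<longlonglongrightarrow> (LINT x|lborel. (u x * (grad \<omega> x \<bullet> b)) * u x)"
    by (rule integral_mult_uniform_limit[OF conte _ _ _ u_loc, rotated 2]) (simp_all add: gr)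
  have I1: "integrable lborel (\<lambda>x. (v n x * (grad \<omega> x \<bullet> b)) * u x)" for n
    using integrable_mult_compact_support[OF conte(1)[of n] _ u_loc] gr by simp
  have I1': "integrable lborel (\<lambda>x. (u x * (grad \<omega> x \<bullet> b)) * u x)"
    using integrable_mult_compact_support[OF conte(2) _ u_loc] gr by simp
  have cw: "continuous_on UNIV (\<lambda>x. u x * \<omega> x)" by (intro continuous_intros cont)
  have one: "(\<integral>\<^sup>+x\<in>cball (0::'a) r. ennreal (1 powr p) \<partial>lborel) < \<infinity>"
    using emeasure_bounded_finite[of "cball (0::'a) r"] by simp
  have F2: "integrable lborel (\<lambda>x. (u x * \<omega> x) * (b \<bullet> mollify (\<kappa> n) G x))"
    "(\<lambda>n. LINT x|lborel. (u x * \<omega> x) * (b \<bullet> mollify (\<kappa> n) G x)) \<longlonglongrightarrow> (LINT x|lborel. (u x * \<omega> x) * (b \<bullet> G x))" for n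
    using flux_limit[where A = "\<lambda>x. b" and B = "\<lambda>x. 1" and r = r and \<zeta> = "\<lambda>n x. u x * \<omega> x"
        and \<zeta>' = "\<lambda>x. u x * \<omega> x" and \<kappa> = \<kappa>, OF _ _ _ one _ cw cw _ _ uniform_limit_const \<kappa>] b r
    by (simp_all add: norm_Basis)
  have Gb_loc: "set_integrable lborel (cball 0 r) (\<lambda>x. G x \<bullet> b)"
    using G_loc[of r] integrable_inner_left[of b lborel "\<lambda>x. indicator (cball 0 r) x *\<^sub>R G x"]
    by (simp add: set_integrable_def)
  have cw2: "continuous_on UNIV (\<lambda>x. v n x * \<omega> x)" for n by (intro continuous_intros cont)
  have "uniform_limit (cball 0 r) (\<lambda>n x. v n x * \<omega> x) (\<lambda>x. u x * \<omega> x) sequentially"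
    by (intro uniform_limit_mult_continuous lim uniform_limit_const continuous_intros cont)
  then have L3: "(\<lambda>n. LINT x|lborel. (v n x * \<omega> x) * (G x \<bullet> b)) \<longlonglongrightarrow> (LINT x|lborel. (u x * \<omega> x) * (G x \<bullet> b))"
    by (rule integral_mult_uniform_limit[OF cw2 cw _ _ _ Gb_loc, rotated 2]) (simp_all add: r)
  have eq: "(LINT x|lborel. (v n x * (grad \<omega> x \<bullet> b)) * u x) + (LINT x|lborel. (u x * \<omega> x) * (b \<bullet> mollify (\<kappa> n) G x))
      = - (LINT x|lborel. (v n x * \<omega> x) * (G x \<bullet> b))" for n
  proof -
    let ?\<phi> = "\<lambda>x. v n x * \<omega> x"
    have t: "?\<phi> \<in> test_functions" by (intro test_function_mult vs \<omega>t)
    have gv: "grad (v n) x = mollify (\<kappa> n) G x" for x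
      unfolding v_def by (rule grad_mollify[OF \<kappa>t])
    have "grad ?\<phi> x = \<omega> x *\<^sub>R mollify (\<kappa> n) G x + v n x *\<^sub>R grad \<omega> x" for x
      unfolding grad_mult[OF vs \<omega>s] gv by simp
    then have "(LINT x|lborel. u x * (grad ?\<phi> x \<bullet> b))
      = (LINT x|lborel. (v n x * (grad \<omega> x \<bullet> b)) * u x + (u x * \<omega> x) * (b \<bullet> mollify (\<kappa> n) G x))"
      by (simp add: inner_add_left inner_commute algebra_simps)
    also have "\<dots> = (LINT x|lborel. (v n x * (grad \<omega> x \<bullet> b)) * u x) + (LINT x|lborel. (u x * \<omega> x) * (b \<bullet> mollify (\<kappa> n) G x))"
      by (intro Bochner_Integration.integral_add I1 F2)
    finally show ?thesis using weak[OF t b] by (simp add: mult_ac)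
  qed
  have "(\<lambda>n. (LINT x|lborel. (v n x * (grad \<omega> x \<bullet> b)) * u x) + (LINT x|lborel. (u x * \<omega> x) * (b \<bullet> mollify (\<kappa> n) G x)))
      \<longlonglongrightarrow> (LINT x|lborel. (u x * (grad \<omega> x \<bullet> b)) * u x) + (LINT x|lborel. (u x * \<omega> x) * (b \<bullet> G x))"
    by (intro tendsto_add L1 F2)
  moreover have "(\<lambda>n. (LINT x|lborel. (v n x * (grad \<omega> x \<bullet> b)) * u x) + (LINT x|lborel. (u x * \<omega> x) * (b \<bullet> mollify (\<kappa> n) G x)))
      \<longlonglongrightarrow> - (LINT x|lborel. (u x * \<omega> x) * (G x \<bullet> b))"
    unfolding eq by (intro tendsto_minus L3)
  ultimately have "(LINT x|lborel. (u x * (grad \<omega> x \<bullet> b)) * u x) + (LINT x|lborel. (u x * \<omega> x) * (b \<bullet> G x))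
    = - (LINT x|lborel. (u x * \<omega> x) * (G x \<bullet> b))"
    by (rule LIMSEQ_unique)
  moreover have "(LINT x|lborel. (u x * \<omega> x) * (G x \<bullet> b)) = 0"
    by (rule integral_eq_zero_AE) (use uG in \<open>auto elim!: eventually_mono\<close>)
  ultimately have "(LINT x|lborel. (u x * (grad \<omega> x \<bullet> b)) * u x) = 0"
    by (simp add: inner_commute)
  moreover have ug: "(u x * (grad \<omega> x \<bullet> b)) * u x = c * (u x)\<^sup>2" for x
    using R(2)[of x] g\<omega>[of x] by (cases "norm x \<le> R") (auto simp: power2_eq_square)
  ultimately have "AE x in lborel. c * (u x)\<^sup>2 = 0"
    using integral_nonneg_eq_0_iff_AE[OF I1'] c by (simp add: ug)
  then have "AE x in lborel. u x = 0" using c by simp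
  then show ?thesis by (rule continuous_eq_0_if_AE[OF u_cont])
qed

end

section \<open>Absorption and decay of the energy\<close>

text \<open>
  Here \<open>U\<close>, \<open>g\<close>, \<open>d\<close>, \<open>H\<close> are the values of \<open>u\<close>, \<open>|\<nabla>u|\<close>, \<open>|\<nabla>\<phi>|\<close>, \<open>h\<close> at a point. Young's inequality
  with \<open>x = g * \<phi>\<close> and \<open>y = U * d\<close> leaves the term \<open>C1 * U^(m+p) * \<phi>^(k+1-p) * d^p\<close>. Either this is
  at most half of the absorption term, or \<open>U^(q-p+1) * \<phi>^p\<close> is bounded by a multiple of \<open>d^p / H\<close>, which
  bounds the whole term because \<open>U^(m+p)\<close> is the power \<open>\<sigma>\<close> of \<open>U^(q-p+1)\<close>. The power \<open>k + 1\<close> of the cutoff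
  is so large that no negative power of \<open>\<phi>\<close> survives.
\<close>

lemma gradient_term_absorbed:
  fixes p q U g \<phi> d H \<sigma> :: real and m k :: nat
  assumes p: "p > 1" and q: "q > p - 1" and \<sigma>: "\<sigma> = (real m + p) / (q - p + 1)"
    and k: "real (Suc k) \<ge> p * (1 + \<sigma>)"
    and nonneg: "U \<ge> 0" "g \<ge> 0" "d \<ge> 0" "0 \<le> \<phi>" "\<phi> \<le> 1" and H: "H > 0"
    and C1: "C1 = real (Suc k) * (real (Suc m) / (2 * real (Suc k))) powr (1 - p)"
  shows "real (Suc k) * \<phi> ^ k * d * U ^ Suc m * g powr (p - 1)
    \<le> real (Suc m) / 2 * (U ^ m * \<phi> ^ Suc k * g powr p) + 1 / 2 * (H * U powr q * U ^ Suc m * \<phi> ^ Suc k)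
      + C1 * (2 * C1) powr \<sigma> * d powr (p * (1 + \<sigma>)) * H powr (- \<sigma>)"
proof -
  have \<sigma>0: "\<sigma> > 0" using p q unfolding \<sigma> by (intro divide_pos_pos) auto
  have "p * 1 < p * (1 + \<sigma>)" using p \<sigma>0 by (intro mult_strict_left_mono) auto
  then have k1: "real (Suc k) > 1" using k p by linarith
  then have k0: "k \<noteq> 0" by auto
  have C10: "C1 > 0" unfolding C1 by simp
  show ?thesis
  proof (cases "U = 0 \<or> \<phi> = 0")
    case True
    then have lhs: "real (Suc k) * \<phi> ^ k * d * U ^ Suc m * g powr (p - 1) = 0" using k0 by auto
    show ?thesis unfolding lhs
      using nonneg H C10 by (intro add_nonneg_nonneg mult_nonneg_nonneg) auto
  next
    case False
    then have U: "U > 0" and \<phi>: "\<phi> > 0" using nonneg by auto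
    define f where "f = \<phi> powr (real (Suc k) - p)"
    \<comment> \<open>makes the coefficient \<open>(k + 1) * \<eta>\<close> of the gradient term half of \<open>m + 1\<close>\<close>
    define \<eta> where "\<eta> = real (Suc m) / (2 * real (Suc k))"
    have f0: "f > 0" using \<phi> by (simp add: f_def)
    have \<phi>k: "\<phi> ^ k = f * \<phi> powr (p - 1)"
      using \<phi> by (simp add: f_def powr_add[symmetric] powr_realpow)
    have \<phi>Sk: "\<phi> ^ Suc k = f * \<phi> powr p"
      using \<phi> by (simp only: f_def powr_add[symmetric] powr_realpow[symmetric]) simp
    have UM: "U ^ Suc m = U ^ m * U" by simp
    have "real (Suc k) * \<phi> ^ k * d * U ^ Suc m * g powr (p - 1)
      = real (Suc k) * U ^ m * f * ((g * \<phi>) powr (p - 1) * (U * d))"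
      unfolding \<phi>k UM using nonneg by (simp add: powr_mult)
    also have "\<dots> \<le> real (Suc k) * U ^ m * f * (\<eta> * (g * \<phi>) powr p + \<eta> powr (1 - p) * (U * d) powr p)"
      using nonneg U \<phi> f0 p by (intro mult_left_mono young_cases) (auto simp: \<eta>_def)
    also have "\<dots> = (real (Suc k) * \<eta>) * (U ^ m * (f * \<phi> powr p) * g powr p)
        + (real (Suc k) * \<eta> powr (1 - p)) * (U ^ m * U powr p) * f * d powr p"
      using nonneg by (simp only: powr_mult) algebra
    also have "real (Suc k) * \<eta> = real (Suc m) / 2" by (simp add: \<eta>_def field_simps)
    also have "real (Suc k) * \<eta> powr (1 - p) = C1" by (simp add: \<eta>_def C1)
    also note \<phi>Sk[symmetric]
    finally have step1: "real (Suc k) * \<phi> ^ k * d * U ^ Suc m * g powr (p - 1)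
      \<le> real (Suc m) / 2 * (U ^ m * \<phi> ^ Suc k * g powr p) + C1 * (U ^ m * U powr p) * f * d powr p" .
    define s where "s = U powr (q - p + 1) * \<phi> powr p"
    define t where "t = 2 * C1 * d powr p / H"
    have "C1 * (U ^ m * U powr p) * f * d powr p \<le> 1 / 2 * (H * U powr q * U ^ Suc m * \<phi> ^ Suc k)
      + C1 * (2 * C1) powr \<sigma> * d powr (p * (1 + \<sigma>)) * H powr (- \<sigma>)"
    proof (cases "t \<le> s")
      case True
      then have "C1 * d powr p \<le> 1 / 2 * (H * s)" using H by (simp add: t_def field_simps)
      then have "(U ^ m * U powr p * f) * (C1 * d powr p) \<le> (U ^ m * U powr p * f) * (1 / 2 * (H * s))"
        using U f0 by (intro mult_left_mono) auto
      also have "\<dots> = 1 / 2 * (H * (U powr p * U powr (q - p + 1)) * U ^ m * (f * \<phi> powr p))"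
        by (simp add: s_def)
      also have "U powr p * U powr (q - p + 1) = U powr q * U"
        using U by (simp add: powr_add[symmetric]) (simp add: powr_add)
      finally have "C1 * (U ^ m * U powr p) * f * d powr p \<le> 1 / 2 * (H * U powr q * U ^ Suc m * \<phi> ^ Suc k)"
        unfolding \<phi>Sk by (simp add: mult_ac)
      then show ?thesis using C10 by (simp add: add_increasing2)
    next
      case False
      have "U ^ m * U powr p = U powr (real m + p)"
        using U by (simp add: powr_add powr_realpow)
      also have "\<dots> = U powr ((q - p + 1) * \<sigma>)" using q by (simp add: \<sigma>)
      finally have "U ^ m * U powr p * \<phi> powr (p * \<sigma>) = s powr \<sigma>"
        using U \<phi> by (simp add: s_def powr_mult powr_powr)
      also have "s powr \<sigma> \<le> t powr \<sigma>"
        using False \<sigma>0 U \<phi> by (intro powr_mono2) (auto simp: s_def)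
      finally have 1: "U ^ m * U powr p * \<phi> powr (p * \<sigma>) \<le> t powr \<sigma>" .
      have "f \<le> \<phi> powr (p * \<sigma>)"
        unfolding f_def using k \<phi> nonneg by (intro powr_mono') (auto simp: algebra_simps)
      then have "U ^ m * U powr p * f \<le> U ^ m * U powr p * \<phi> powr (p * \<sigma>)"
        using U by (intro mult_left_mono) auto
      with 1 have "U ^ m * U powr p * f \<le> t powr \<sigma>" by linarith
      then have "C1 * d powr p * (U ^ m * U powr p * f) \<le> C1 * d powr p * t powr \<sigma>"
        using C10 by (intro mult_left_mono) auto
      also have "\<dots> = C1 * (2 * C1) powr \<sigma> * d powr (p * (1 + \<sigma>)) * H powr (- \<sigma>)"
        using C10 H nonneg
        by (simp add: t_def powr_mult powr_divide powr_powr powr_add powr_minus field_simps)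
      finally have "C1 * (U ^ m * U powr p) * f * d powr p \<le> C1 * (2 * C1) powr \<sigma> * d powr (p * (1 + \<sigma>)) * H powr (- \<sigma>)"
        by (simp add: mult_ac)
      then show ?thesis using H U \<phi> by (simp add: add_increasing)
    qed
    with step1 show ?thesis by linarith
  qed
qed

lemma powr_lower_bound_annulus:
  fixes R t \<gamma> :: real
  assumes "R > 0" "R \<le> t" "t \<le> 2 * R"
  shows "min 1 (2 powr \<gamma>) * R powr \<gamma> \<le> t powr \<gamma>"
proof (cases "\<gamma> \<ge> 0")
  case True
  have "min 1 (2 powr \<gamma>) * R powr \<gamma> \<le> 1 * R powr \<gamma>" by (intro mult_right_mono) auto
  also have "\<dots> \<le> t powr \<gamma>" using True assms by (simp add: powr_mono2)
  finally show ?thesis .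
next
  case False
  have "min 1 (2 powr \<gamma>) * R powr \<gamma> \<le> 2 powr \<gamma> * R powr \<gamma>" by (intro mult_right_mono) auto
  also have "\<dots> = (2 * R) powr \<gamma>" using assms by (simp add: powr_mult)
  also have "\<dots> \<le> t powr \<gamma>" using False assms by (intro powr_mono2') auto
  finally show ?thesis .
qed

context p_subsolution
begin

text \<open>
  The error term of \<open>gradient_term_absorbed\<close> is integrated over the annulus of radii \<open>R\<close> and \<open>2 * R\<close>,
  where \<open>|\<nabla>\<phi>|\<close> is of order \<open>1/R\<close> and \<open>h\<close> of order \<open>R^\<gamma>\<close>. The result is of order
  \<open>R^(N - p * (1 + \<sigma>) - \<gamma> * \<sigma>)\<close>, and the assumption on \<open>\<sigma>\<close> makes the exponent at most \<open>-p\<close>.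
\<close>

lemma energy_decay:
  fixes h :: "'a \<Rightarrow> real" and q a \<gamma> \<sigma> R0 :: real and m :: nat
  assumes H: "\<And>x. H x = h x * u x powr q" and h0: "\<And>x. h x \<ge> 0"
    and a: "a > 0" and R0: "\<And>x. norm x \<ge> R0 \<Longrightarrow> h x = a * norm x powr \<gamma>"
    and q: "q > p - 1" and \<sigma>: "\<sigma> = (real m + p) / (q - p + 1)" and big: "(p + \<gamma>) * \<sigma> \<ge> real DIM('a)"
  obtains K where "\<And>r R. R \<ge> 1 \<Longrightarrow> R \<ge> R0 \<Longrightarrow> R \<ge> r \<Longrightarrow>
    (\<integral>\<^sup>+x\<in>cball 0 r. ennreal (u x ^ m * norm (G x) powr p + H x * u x ^ Suc m) \<partial>lborel) \<le> ennreal (K * R powr (- p))"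
proof -
  obtain \<phi> :: "real \<Rightarrow> 'a \<Rightarrow> real" and c D :: real where c: "c > 0"
    and \<phi>: "\<forall>R>0. \<phi> R \<in> test_functions \<and> (\<forall>x. 0 \<le> \<phi> R x \<and> \<phi> R x \<le> 1 \<and> norm (grad (\<phi> R) x) \<le> D / R
      \<and> (norm x \<le> R \<longrightarrow> \<phi> R x = c \<and> grad (\<phi> R) x = 0)
      \<and> (norm x \<ge> 2 * R \<longrightarrow> \<phi> R x = 0 \<and> grad (\<phi> R) x = 0))"
    using cutoff_family by (elim exE conjE)
  have \<sigma>0: "\<sigma> > 0" using p q unfolding \<sigma> by (intro divide_pos_pos) auto
  obtain k :: nat where "real k \<ge> p * (1 + \<sigma>)" using real_arch_simple by blast
  then have k: "real (Suc k) \<ge> p * (1 + \<sigma>)" by simp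
  define C1 where "C1 = real (Suc k) * (real (Suc m) / (2 * real (Suc k))) powr (1 - p)"
  define C where "C = C1 * (2 * C1) powr \<sigma>"
  define a' where "a' = a * min 1 (2 powr \<gamma>)"
  define V where "V = unit_ball_vol (real DIM('a)) * 2 ^ DIM('a)"
  define K where "K = 2 / c ^ Suc k * (C * \<bar>D\<bar> powr (p * (1 + \<sigma>)) * a' powr (- \<sigma>) * V)"
  have C0: "C > 0" "a' > 0" "V > 0" using a by (simp_all add: C_def C1_def a'_def V_def)
  show thesis
  proof (rule that[of K])
    fix r R :: real assume R: "R \<ge> 1" "R \<ge> R0" "R \<ge> r"
    define W where "W = C * (\<bar>D\<bar> / R) powr (p * (1 + \<sigma>)) * (a' * R powr \<gamma>) powr (- \<sigma>)"
    have "R > 0" using R by simp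
    note \<phi>R = \<phi>[rule_format, OF \<open>R > 0\<close>]
    define \<psi> where "\<psi> x = \<phi> R x ^ Suc k" for x
    have \<phi>s: "smooth (\<phi> R)" using \<phi>R test_functionsD(1) by blast
    have "(\<lambda>x. \<phi> R x ^ k * \<phi> R x) \<in> test_functions"
      using \<phi>R \<phi>s by (intro test_function_mult smooth_power) auto
    then have \<psi>t: "\<psi> \<in> test_functions" by (simp add: \<psi>_def[abs_def] mult.commute)
    have \<psi>0: "\<psi> x \<ge> 0" for x using \<phi>R by (simp add: \<psi>_def)
    have g\<psi>: "grad \<psi> x = (real (Suc k) * \<phi> R x ^ k) *\<^sub>R grad (\<phi> R) x" for x
      unfolding \<psi>_def by (rule grad_power_Suc[OF \<phi>s])
    define E1 where "E1 x = real (Suc m) * u x ^ m * \<psi> x * norm (G x) powr p" for x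
    define E2 where "E2 x = u x ^ Suc m * (flux x \<bullet> grad \<psi> x)" for x
    define E3 where "E3 x = H x * (u x ^ Suc m * \<psi> x)" for x
    note E = energy_inequality[OF \<psi>t \<psi>0, of m, folded E1_def E2_def E3_def]
    have lower: "E1 x / 2 + E3 x / 2 - W * indicator (cball 0 (2 * R)) x \<le> E1 x + E2 x + E3 x" for x
    proof (cases "grad (\<phi> R) x = 0")
      case True
      have "E1 x \<ge> 0" "E3 x \<ge> 0"
        using u_nonneg \<psi>0 h0 by (simp_all add: E1_def E3_def H)
      moreover have "W * indicator (cball 0 (2 * R)) x \<ge> 0" using C0 by (simp add: W_def)
      ultimately show ?thesis using True by (simp add: E2_def g\<psi>)
    next
      case False
      then have x: "norm x > R" "norm x < 2 * R" using \<phi>R not_le by blast+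
      let ?d = "norm (grad (\<phi> R) x)"
      have hx: "h x \<ge> a' * R powr \<gamma>"
        using powr_lower_bound_annulus[of R "norm x" \<gamma>] x R a R0[of x] by (simp add: a'_def mult.assoc)
      have hx0: "a' * R powr \<gamma> > 0" using C0 R by simp
      have "- E2 x \<le> u x ^ Suc m * (norm (flux x) * norm (grad \<psi> x))"
        using mult_left_mono[OF Cauchy_Schwarz_ineq2[of "flux x" "grad \<psi> x"], of "u x ^ Suc m"]
          u_nonneg[of x] abs_ge_minus_self[of "flux x \<bullet> grad \<psi> x"] mult_left_mono[of "- (flux x \<bullet> grad \<psi> x)" "\<bar>flux x \<bullet> grad \<psi> x\<bar>" "u x ^ Suc m"]
        unfolding E2_def by (simp del: power_Suc)
      also have "\<dots> = real (Suc k) * \<phi> R x ^ k * ?d * u x ^ Suc m * norm (G x) powr (p - 1)"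
        using \<phi>R by (simp add: norm_flux g\<psi>)
      also have "\<dots> \<le> real (Suc m) / 2 * (u x ^ m * \<phi> R x ^ Suc k * norm (G x) powr p)
        + 1 / 2 * (h x * u x powr q * u x ^ Suc m * \<phi> R x ^ Suc k)
        + C1 * (2 * C1) powr \<sigma> * ?d powr (p * (1 + \<sigma>)) * h x powr (- \<sigma>)"
        using \<phi>R u_nonneg hx hx0 by (intro gradient_term_absorbed[OF p q \<sigma> k]) (auto simp: C1_def)
      also have "\<dots> = E1 x / 2 + E3 x / 2 + C * (?d powr (p * (1 + \<sigma>)) * h x powr (- \<sigma>))"
        by (simp add: E1_def E3_def C_def \<psi>_def H)
      also have "C * (?d powr (p * (1 + \<sigma>)) * h x powr (- \<sigma>)) \<le> C * ((\<bar>D\<bar> / R) powr (p * (1 + \<sigma>)) * (a' * R powr \<gamma>) powr (- \<sigma>))"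
      proof (intro mult_left_mono mult_mono)
        have "D / R \<le> \<bar>D\<bar> / R" using R by (intro divide_right_mono) auto
        then show "?d powr (p * (1 + \<sigma>)) \<le> (\<bar>D\<bar> / R) powr (p * (1 + \<sigma>))"
          using \<phi>R p \<sigma>0 by (intro powr_mono2) (auto intro: order_trans)
        show "h x powr (- \<sigma>) \<le> (a' * R powr \<gamma>) powr (- \<sigma>)"
          using \<sigma>0 hx hx0 by (intro powr_mono2') auto
      qed (use C0 in auto)
      also have "\<dots> = W * indicator (cball 0 (2 * R)) x"
        using x by (simp add: W_def)
      finally show ?thesis by simp
    qed
    have intE: "integrable lborel (\<lambda>x. E1 x / 2 + E3 x / 2)"
      using E(1,3) by simp
    have int1: "integrable lborel (\<lambda>x. W * indicator (cball (0::'a) (2 * R)) x)"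
      using emeasure_bounded_finite[of "cball (0::'a) (2 * R)"] by simp
    have "(LINT x|lborel. E1 x / 2 + E3 x / 2 - W * indicator (cball 0 (2 * R)) x) \<le> (LINT x|lborel. E1 x + E2 x + E3 x)"
      by (rule integral_mono[OF _ _ lower]) (use intE int1 E in auto)
    also have "\<dots> \<le> 0" by (rule E(4))
    finally have "(LINT x|lborel. E1 x / 2 + E3 x / 2) \<le> (LINT x|lborel. W * indicator (cball (0::'a) (2 * R)) x)"
      by (subst (asm) Bochner_Integration.integral_diff[OF intE int1]) simp
    also have "\<dots> = W * (V * R ^ DIM('a))"
      using R by (simp add: content_cball V_def power_mult_distrib)
    also have "\<dots> = C * \<bar>D\<bar> powr (p * (1 + \<sigma>)) * a' powr (- \<sigma>) * V * R powr (real DIM('a) - p * (1 + \<sigma>) - \<gamma> * \<sigma>)"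
    proof -
      have "R ^ DIM('a) = R powr real DIM('a)" using R by (simp add: powr_realpow)
      then show ?thesis
        using R C0 by (simp add: W_def powr_divide powr_mult powr_powr powr_diff powr_minus field_simps)
          (simp add: powr_add mult_ac)
    qed
    also have "\<dots> \<le> C * \<bar>D\<bar> powr (p * (1 + \<sigma>)) * a' powr (- \<sigma>) * V * R powr (- p)"
      using R big C0 by (intro mult_left_mono powr_mono) (auto simp: algebra_simps)
    finally have le: "(LINT x|lborel. E1 x / 2 + E3 x / 2) \<le> C * \<bar>D\<bar> powr (p * (1 + \<sigma>)) * a' powr (- \<sigma>) * V * R powr (- p)" .
    let ?P = "\<lambda>x. u x ^ m * norm (G x) powr p + H x * u x ^ Suc m"
    have P0: "?P x \<ge> 0" for x using u_nonneg h0 by (simp add: H)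
    have "(\<integral>\<^sup>+x\<in>cball 0 r. ennreal (?P x) \<partial>lborel) \<le> (\<integral>\<^sup>+x. ennreal (2 / c ^ Suc k * (E1 x / 2 + E3 x / 2)) \<partial>lborel)"
    proof (intro nn_integral_mono)
      fix x
      have E0: "E1 x \<ge> 0" "E3 x \<ge> 0"
        using u_nonneg \<psi>0 h0 by (simp_all add: E1_def E3_def H)
      show "ennreal (?P x) * indicator (cball 0 r) x \<le> ennreal (2 / c ^ Suc k * (E1 x / 2 + E3 x / 2))"
      proof (cases "norm x \<le> r")
        case True
        then have "\<psi> x = c ^ Suc k" using \<phi>R R by (simp add: \<psi>_def)
        then have "2 / c ^ Suc k * (E1 x / 2 + E3 x / 2) = real (Suc m) * (u x ^ m * norm (G x) powr p) + H x * u x ^ Suc m"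
          using c by (simp add: E1_def E3_def field_simps)
        moreover have "1 * (u x ^ m * norm (G x) powr p) \<le> real (Suc m) * (u x ^ m * norm (G x) powr p)"
          using u_nonneg by (intro mult_right_mono) auto
        ultimately show ?thesis using True by (auto intro!: ennreal_leI)
      next
        case False
        then show ?thesis by simp
      qed
    qed
    also have "\<dots> = ennreal (LINT x|lborel. 2 / c ^ Suc k * (E1 x / 2 + E3 x / 2))"
      using intE u_nonneg \<psi>0 h0 c
      by (intro nn_integral_eq_integral integrable_mult_right AE_I2 mult_nonneg_nonneg) (auto simp: E1_def E3_def H)
    also have "\<dots> = ennreal (2 / c ^ Suc k * (LINT x|lborel. E1 x / 2 + E3 x / 2))"
      by (subst integral_mult_right_zero) simp
    also have "\<dots> \<le> ennreal (K * R powr (- p))"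
      using mult_left_mono[OF le, of "2 / c ^ Suc k"] c by (intro ennreal_leI) (simp add: K_def mult.assoc)
    finally show "(\<integral>\<^sup>+x\<in>cball 0 r. ennreal (?P x) \<partial>lborel) \<le> ennreal (K * R powr (- p))" .
  qed
qed

text \<open>
  As \<open>m\<close> grows, \<open>(p + \<gamma>) * (m + p) / (q - p + 1)\<close> exceeds the dimension, and then \<open>energy_decay\<close> with
  \<open>R\<close> tending to infinity makes all local energies vanish. Since \<open>h\<close> is positive
  where \<open>|x|\<close> is large, \<open>u\<close> has compact support, and \<open>G = 0\<close> almost everywhere on \<open>{u \<noteq> 0}\<close>.
\<close>

lemma liouville:
  fixes h :: "'a \<Rightarrow> real" and q a \<gamma> R0 :: real
  assumes H: "\<And>x. H x = h x * u x powr q" and h0: "\<And>x. h x \<ge> 0"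
    and a: "a > 0" and \<gamma>: "\<gamma> > - p" and R0: "\<And>x. norm x \<ge> R0 \<Longrightarrow> h x = a * norm x powr \<gamma>"
    and q: "q > p - 1"
  shows "u x = 0"
proof -
  obtain m :: nat where "real m \<ge> real DIM('a) * (q - p + 1) / (p + \<gamma>)"
    using real_arch_simple by blast
  then have "real DIM('a) * (q - p + 1) / (p + \<gamma>) \<le> real m + p"
    using p by simp
  then have big: "(p + \<gamma>) * ((real m + p) / (q - p + 1)) \<ge> real DIM('a)"
    using \<gamma> q by (simp add: field_simps)
  let ?P = "\<lambda>x. u x ^ m * norm (G x) powr p + H x * u x ^ Suc m"
  have [measurable]: "u \<in> borel_measurable borel" "H \<in> borel_measurable borel"
    by (intro borel_measurable_continuous_onI u_cont H_cont)+
  have nonneg: "u x ^ m * norm (G x) powr p \<ge> 0" "H x * u x ^ Suc m \<ge> 0" for x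
    using u_nonneg h0 by (simp_all add: H)
  obtain K where K: "\<And>r R. R \<ge> 1 \<Longrightarrow> R \<ge> R0 \<Longrightarrow> R \<ge> r \<Longrightarrow>
    (\<integral>\<^sup>+x\<in>cball 0 r. ennreal (?P x) \<partial>lborel) \<le> ennreal (K * R powr (- p))"
    using energy_decay[OF H h0 a R0 q refl big] by blast
  have "AE x in lborel. norm x \<le> r \<longrightarrow> ?P x = 0" for r
  proof -
    have "((\<lambda>R. K * R powr (- p)) \<longlongrightarrow> K * 0) at_top"
      using p by (intro tendsto_intros tendsto_neg_powr filterlim_ident) auto
    then have "((\<lambda>R. ennreal (K * R powr (- p))) \<longlongrightarrow> ennreal 0) at_top"
      by (intro tendsto_ennrealI) simp
    moreover have "eventually (\<lambda>R. (\<integral>\<^sup>+x\<in>cball 0 r. ennreal (?P x) \<partial>lborel) \<le> ennreal (K * R powr (- p))) at_top"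
      by (rule eventually_mono[OF eventually_ge_at_top[of "max 1 (max R0 r)"]]) (rule K, auto)
    ultimately have "(\<integral>\<^sup>+x\<in>cball 0 r. ennreal (?P x) \<partial>lborel) \<le> ennreal 0"
      by (rule tendsto_lowerbound) simp
    then have "(\<integral>\<^sup>+x\<in>cball 0 r. ennreal (?P x) \<partial>lborel) = 0" by simp
    then have "AE x in lborel. ennreal (?P x) * indicator (cball 0 r) x = 0"
      by (subst (asm) nn_integral_0_iff_AE) measurable
    then show ?thesis
    proof (rule eventually_mono, intro impI)
      fix x assume "ennreal (?P x) * indicator (cball 0 r) x = 0" "norm x \<le> r"
      then have "?P x \<le> 0" by (auto simp: ennreal_eq_0_iff)
      then show "?P x = 0" using nonneg[of x] by linarith
    qed
  qed
  then have "AE x in lborel. \<forall>n::nat. norm x \<le> real n \<longrightarrow> ?P x = 0"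
    by (subst AE_all_countable) blast
  then have P: "AE x in lborel. ?P x = 0"
    by (rule eventually_mono) (use real_arch_simple in blast)
  have "AE x in lborel. H x * u x ^ Suc m = 0"
    using P by (rule eventually_mono) (use nonneg in \<open>smt (verit)\<close>)
  then have Hu: "H x * u x ^ Suc m = 0" for x
    by (rule continuous_eq_0_if_AE[rotated]) (intro continuous_intros H_cont u_cont)
  have out: "u x = 0" if "norm x \<ge> max 1 R0" for x
  proof (rule ccontr)
    assume "u x \<noteq> 0"
    moreover have "h x > 0"
    proof -
      have "norm x \<noteq> 0" using that by linarith
      then show ?thesis using that a R0[of x] by simp
    qed
    ultimately show False using Hu[of x] by (simp add: H)
  qed
  have uG: "AE x in lborel. u x = 0 \<or> G x = 0"
    using P
  proof (rule eventually_mono)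
    fix x assume "?P x = 0"
    then have "u x ^ m * norm (G x) powr p = 0" using nonneg[of x] by linarith
    then show "u x = 0 \<or> G x = 0" by auto
  qed
  show ?thesis
    by (rule eq_0_if_gradient_vanishes_where_nonzero[OF uG, of "max 1 R0"], simp, rule out)
qed

end

section \<open>From Lebesgue to Borel measurable gradients\<close>

lemma lebesgue_borel_version:
  fixes G :: "'a::euclidean_space \<Rightarrow> 'b::euclidean_space"
  assumes "G \<in> borel_measurable lebesgue"
  shows "\<exists>G'. G' \<in> borel_measurable borel \<and> (AE x in lborel. G x = G' x)"
proof -
  have "\<exists>g\<in>borel_measurable lborel. AE x in lborel. G x \<bullet> b = g x" for b
    using assms by (intro completion_ex_borel_measurable_real) auto
  then obtain g where g: "\<And>b. g b \<in> borel_measurable lborel" "\<And>b. AE x in lborel. G x \<bullet> b = g b x"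
    by metis
  note [measurable] = g(1)
  have "AE x in lborel. \<forall>b\<in>Basis. G x \<bullet> b = g b x"
    using g(2) by (intro AE_finite_allI) auto
  then have "AE x in lborel. G x = (\<Sum>b\<in>Basis. g b x *\<^sub>R b)"
  proof (rule eventually_mono)
    fix x assume "\<forall>b\<in>Basis. G x \<bullet> b = g b x"
    then have "(\<Sum>b\<in>Basis. g b x *\<^sub>R b) = (\<Sum>b\<in>Basis. (G x \<bullet> b) *\<^sub>R b)" by simp
    then show "G x = (\<Sum>b\<in>Basis. g b x *\<^sub>R b)" by (simp add: euclidean_representation)
  qed
  moreover have "(\<lambda>x. \<Sum>b\<in>Basis. g b x *\<^sub>R b) \<in> borel_measurable borel"
    using g(1) by measurable
  ultimately show ?thesis by blast
qed

lemma integral_lebesgue_eq_lborel: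
  fixes f g :: "'a::euclidean_space \<Rightarrow> real"
  assumes "f \<in> borel_measurable lebesgue" "g \<in> borel_measurable borel" "AE x in lborel. f x = g x"
  shows "(LINT x|lebesgue. f x) = (LINT x|lborel. g x)"
proof -
  have "(LINT x|lebesgue. f x) = (LINT x|lebesgue. g x)"
    using assms by (intro integral_cong_AE) (auto intro: AE_completion measurable_completion)
  also have "\<dots> = (LINT x|lborel. g x)"
    using assms by (intro integral_completion) auto
  finally show ?thesis .
qed

lemma continuous_borel_lebesgue:
  fixes f :: "'a::euclidean_space \<Rightarrow> 'b::euclidean_space"
  assumes "continuous_on UNIV f"
  shows "f \<in> borel_measurable borel" "f \<in> borel_measurable lebesgue"
proof -
  show "f \<in> borel_measurable borel" by (rule borel_measurable_continuous_onI[OF assms])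
  then show "f \<in> borel_measurable lebesgue" by (intro measurable_completion) simp
qed

theorem theorem4p1:
  fixes p q a \<gamma> :: real and h u :: "real ^ 'n \<Rightarrow> real"
  assumes "p > 1"
    and "continuous_on UNIV h" and "\<And>x. h x \<ge> 0"
    and "a > 0" and "\<gamma> > - p"
    and "eventually (\<lambda>x. h x = a * norm x powr \<gamma>) at_infinity"
    and "u \<in> W1p_loc p" and "continuous_on UNIV u" and "\<And>x. u x \<ge> 0"
    and "weak_p_laplace_le p u (\<lambda>x. - (h x * u x powr q))"
    and "q > p - 1"
  shows "\<forall>x. u x = 0"
proof -
  obtain G where G: "G \<in> Lp_loc p" and wG: "weak_gradient u G"
    and sub: "\<And>\<phi>. \<phi> \<in> test_functions \<Longrightarrow> (\<And>x. \<phi> x \<ge> 0) \<Longrightarrow>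
           (LINT x|lebesgue. (norm (G x) powr (p - 2) *\<^sub>R G x) \<bullet> grad \<phi> x)
             \<le> (LINT x|lebesgue. - (h x * u x powr q) * \<phi> x)"
    using assms(10) unfolding weak_p_laplace_le_def by blast
  have Gm[measurable]: "G \<in> borel_measurable lebesgue" using G by (simp add: Lp_loc_def)
  from lebesgue_borel_version[OF Gm]
  obtain G' where G'AE: "G' \<in> borel_measurable borel \<and> (AE x in lborel. G x = G' x)" ..
  then have G': "G' \<in> borel_measurable borel" and AE: "AE x in lborel. G x = G' x"
    by (rule conjunct1, rule conjunct2)
  note [measurable] = G'
  have Gm'[measurable]: "G' \<in> borel_measurable lebesgue"
    by (rule measurable_completion) (simp add: G')
  have H_cont: "continuous_on UNIV (\<lambda>x. h x * u x powr q)"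
    using assms by (intro continuous_intros continuous_on_powr') auto
  interpret p_subsolution p u G' "\<lambda>x. h x * u x powr q"
  proof
    fix r
    have "set_integrable lebesgue (cball 0 r) (\<lambda>x. norm (G x) powr p)"
      using G by (simp add: Lp_loc_def)
    then have "(\<integral>\<^sup>+x. ennreal (norm (indicator (cball 0 r) x *\<^sub>R (norm (G x) powr p))) \<partial>lborel) < \<infinity>"
      unfolding set_integrable_def integrable_iff_bounded nn_integral_completion by blast
    also have "(\<integral>\<^sup>+x. ennreal (norm (indicator (cball 0 r) x *\<^sub>R (norm (G x) powr p))) \<partial>lborel)
      = (\<integral>\<^sup>+x\<in>cball 0 r. ennreal (norm (G' x) powr p) \<partial>lborel)"
      using AE by (intro nn_integral_cong_AE) (auto elim!: eventually_mono simp: indicator_def)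
    finally show "(\<integral>\<^sup>+x\<in>cball 0 r. ennreal (norm (G' x) powr p) \<partial>lborel) < \<infinity>" .
  next
    fix \<phi> :: "real ^ 'n \<Rightarrow> real" and b :: "real ^ 'n" assume \<phi>: "\<phi> \<in> test_functions" and b: "b \<in> Basis"
    have \<phi>s: "smooth \<phi>" using \<phi> by (rule test_functionsD)
    note [measurable] = continuous_borel_lebesgue[OF smooth_continuous[OF \<phi>s]]
    have m: "(\<lambda>x. u x * (grad \<phi> x \<bullet> b)) \<in> borel_measurable borel"
      by (intro borel_measurable_continuous_onI continuous_intros assms smooth_grad_continuous \<phi>s)
    have "(LINT x|lborel. u x * (grad \<phi> x \<bullet> b)) = (LINT x|lebesgue. u x * (grad \<phi> x \<bullet> b))"
      using m by (intro integral_completion[symmetric]) simp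
    also have "\<dots> = - (LINT x|lebesgue. (G x \<bullet> b) * \<phi> x)"
      using wG \<phi> b by (simp add: weak_gradient_def)
    also have "(LINT x|lebesgue. (G x \<bullet> b) * \<phi> x) = (LINT x|lborel. (G' x \<bullet> b) * \<phi> x)"
      using AE by (intro integral_lebesgue_eq_lborel) (measurable, auto elim!: eventually_mono)
    finally show "(LINT x|lborel. u x * (grad \<phi> x \<bullet> b)) = - (LINT x|lborel. (G' x \<bullet> b) * \<phi> x)" .
  next
    fix \<phi> :: "real ^ 'n \<Rightarrow> real" assume \<phi>: "\<phi> \<in> test_functions" "\<And>x. \<phi> x \<ge> 0"
    have \<phi>s: "smooth \<phi>" using \<phi>(1) by (rule test_functionsD)
    note [measurable] = continuous_borel_lebesgue[OF smooth_grad_continuous[OF \<phi>s]]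
    have m: "(\<lambda>x. - (h x * u x powr q) * \<phi> x) \<in> borel_measurable borel"
      by (intro borel_measurable_continuous_onI continuous_on_mult continuous_on_minus H_cont smooth_continuous \<phi>s)
    have "(LINT x|lborel. (norm (G' x) powr (p - 2) *\<^sub>R G' x) \<bullet> grad \<phi> x)
      = (LINT x|lebesgue. (norm (G x) powr (p - 2) *\<^sub>R G x) \<bullet> grad \<phi> x)"
      using AE by (intro integral_lebesgue_eq_lborel[symmetric]) (measurable, auto elim!: eventually_mono)
    also have "\<dots> \<le> (LINT x|lebesgue. - (h x * u x powr q) * \<phi> x)"
      by (rule sub[OF \<phi>])
    also have "\<dots> = (LINT x|lborel. - (h x * u x powr q) * \<phi> x)"
      using m by (intro integral_completion) simp
    also have "\<dots> = - (LINT x|lborel. h x * u x powr q * \<phi> x)" by simp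
    finally show "(LINT x|lborel. (norm (G' x) powr (p - 2) *\<^sub>R G' x) \<bullet> grad \<phi> x) \<le> - (LINT x|lborel. h x * u x powr q * \<phi> x)" .
  qed (use assms G' H_cont in auto)
  obtain R0 where "\<And>x. norm x \<ge> R0 \<Longrightarrow> h x = a * norm x powr \<gamma>"
    using assms(6) unfolding eventually_at_infinity by blast
  then have "u x = 0" for x
    by (rule liouville[OF refl assms(3,4,5) _ assms(11)])
  then show ?thesis by blast
qed

end
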